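(* Let $\pi:(M,g,J)\to(N,g_N)$ be a (proper) bi-slant submersion from a Kähler manifold onto a Riemannian manifold. Then the slant distribution $\mathcal D^{\theta_2}$ defines a totally geodesic foliation on $\ker\pi_*$ if and only if $$g\big(\mathcal T_{PX}FV-\mathcal T_X FPV+\mathcal A_{FX}FV,\;U\big)=0,$$ where $X\in\mathcal D^{\theta_1}$ and $U,V\in\mathcal D^{\theta_2}$.
   Context: A Riemannian submersion $\pi:(M,g)\to(N,g_N)$, $\dim M>\dim N$, is a surjective map of maximal rank such that $\pi_*$ restricted to $(\ker\pi_* )^\perp$ is a linear isometry. Vector fields in $\ker\pi_*$ are vertical, those in $(\ker\pi_* )^\perp$ horizontal; $\mathcal V,\mathcal H$ are the projections onto $\ker\pi_*$ and $(\ker\pi_* )^\perp$. A vector field on $M$ is basic if it is horizontal and $\pi$-related to a vector field on $N$. Standing convention: all horizontal vector fields are assumed to be basic. $\nabla$ is the Levi-Civita connection of $g$. O'Neill's tensors are $\mathcal T_E G=\mathcal V\nabla_{\mathcal V E}\mathcal H G+\mathcal H\nabla_{\mathcal V E}\mathcal V G$ and $\mathcal A_E G=\mathcal V\nabla_{\mathcal H E}\mathcal H G+\mathcal H\nabla_{\mathcal H E}\mathcal V G$. For vertical $V,W$, $\hat\nabla_V W=\mathcal V\nabla_V W$. Kähler means $J^2=-I$, $g(JX,JY)=g(X,Y)$, $\nabla J=0$. For $V\in\ker\pi_*$ write $JV=PV+FV$ with $PV$ vertical and $FV$ horizontal. A distribution $\mathcal D$ is slant with slant angle $\theta$ if for every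 point $p$ and every nonzero $X\in\mathcal D_p$ the angle between $JX$ and $\mathcal D_p$ equals the constant $\theta$. A Riemannian submersion $\pi$ from a Kähler manifold is a bi-slant submersion if there are two slant distributions $\mathcal D^{\theta_1},\mathcal D^{\theta_2}\subset\ker\pi_*$, with slant angles $\theta_1$ and $\theta_2$ respectively, such that $\ker\pi_*=\mathcal D^{\theta_1}\oplus\mathcal D^{\theta_2}$. It is proper if each slant angle is different from $0$ and $\pi/2$. $\mathcal D^{\theta_2}$ defines a totally geodesic foliation on $\ker\pi_*$ if $\hat\nabla_U V\in\mathcal D^{\theta_2}$ for all $U,V\in\mathcal D^{\theta_2}$.
   Formalization: The direct sum is taken orthogonal; J D^{θ1} ⟂ D^{θ2} is added (the claim fails without it); "all horizontal fields are basic", literally inconsistent, is read as: each vector of D^{θi} (i=1,2) extends to a section V of D^{θi} with FV basic near the point. *)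

theory Defs
  imports "HOL-Analysis.Analysis" "HOL-Library.Function_Algebras"
begin

text \<open>Tangent vectors are functionals on real-valued functions; the pointwise vector space
  structure makes \<^const>\<open>span\<close> and \<^const>\<open>dim\<close> available for subspaces of tangent spaces.\<close>

instantiation "fun" :: (type, real_vector) real_vector
begin

definition scaleR_fun :: "real \<Rightarrow> ('a \<Rightarrow> 'b) \<Rightarrow> 'a \<Rightarrow> 'b"
  where "scaleR_fun c f = (\<lambda>x. c *\<^sub>R f x)"

instance
  by standard (auto simp: scaleR_fun_def plus_fun_def fun_eq_iff scaleR_add_right scaleR_add_left)

end


section \<open>Smooth manifolds\<close>

text \<open>Meant for open \<open>S\<close> in a finite-dimensional space, where continuity of all iterated
  directional derivatives is the same as being \<open>C\<^sup>k\<close>.\<close>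

fun ck_on :: "nat \<Rightarrow> 'a::real_normed_vector set \<Rightarrow> ('a \<Rightarrow> 'b::real_normed_vector) \<Rightarrow> bool" where
  "ck_on 0 S f = continuous_on S f"
| "ck_on (Suc k) S f =
    ((\<forall>x\<in>S. f differentiable (at x)) \<and> (\<forall>v. ck_on k S (\<lambda>x. frechet_derivative f (at x) v)))"

definition smooth_on :: "'a::real_normed_vector set \<Rightarrow> ('a \<Rightarrow> 'b::real_normed_vector) \<Rightarrow> bool"
  where "smooth_on S f \<longleftrightarrow> (\<forall>k. ck_on k S f)"

text \<open>A smooth manifold is a whole type \<open>'m\<close> (Hausdorff and second countable by its type class)
  with an atlas of charts \<open>(U, \<phi>)\<close> into a Euclidean space \<open>'e\<close>; its dimension is \<open>DIM('e)\<close>.\<close>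

type_synonym ('m, 'e) atlas = "('m set \<times> ('m \<Rightarrow> 'e)) set"

definition smooth_atlas ::
    "('m::{t2_space,second_countable_topology}, 'e::euclidean_space) atlas \<Rightarrow> bool" where
  "smooth_atlas M \<longleftrightarrow>
     (\<Union>(U, \<phi>)\<in>M. U) = UNIV \<and>
     (\<forall>(U, \<phi>)\<in>M. open U \<and> open (\<phi> ` U) \<and> homeomorphism U (\<phi> ` U) \<phi> (inv_into U \<phi>)) \<and>
     (\<forall>(U, \<phi>)\<in>M. \<forall>(W, \<psi>)\<in>M. smooth_on (\<phi> ` (U \<inter> W)) (\<psi> \<circ> inv_into U \<phi>))"

definition smooth_fun :: "('m::topological_space, 'e::euclidean_space) atlas \<Rightarrow> ('m \<Rightarrow> real) set"
  where "smooth_fun M = {f. \<forall>(U, \<phi>)\<in>M. smooth_on (\<phi> ` U) (f \<circ> inv_into U \<phi>)}"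

definition smooth_map ::
    "('m::topological_space, 'e::euclidean_space) atlas \<Rightarrow>
     ('n::topological_space, 'd::euclidean_space) atlas \<Rightarrow> ('m \<Rightarrow> 'n) \<Rightarrow> bool" where
  "smooth_map M N \<pi> \<longleftrightarrow>
     continuous_on UNIV \<pi> \<and>
     (\<forall>(U, \<phi>)\<in>M. \<forall>(W, \<psi>)\<in>N. smooth_on (\<phi> ` (U \<inter> \<pi> -` W)) (\<psi> \<circ> \<pi> \<circ> inv_into U \<phi>))"

type_synonym 'm tvec = "('m \<Rightarrow> real) \<Rightarrow> real"
type_synonym 'm vfield = "'m \<Rightarrow> 'm tvec"

text \<open>Tangent vectors are derivations of the smooth functions; the last clause fixes their value
  on other arguments, so that equality of functionals is equality of tangent vectors.\<close>

definition tangent_space ::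
    "('m::topological_space, 'e::euclidean_space) atlas \<Rightarrow> 'm \<Rightarrow> 'm tvec set" where
  "tangent_space M p = {v.
     (\<forall>f\<in>smooth_fun M. \<forall>h\<in>smooth_fun M. v (f + h) = v f + v h) \<and>
     (\<forall>c. \<forall>f\<in>smooth_fun M. v (c *\<^sub>R f) = c * v f) \<and>
     (\<forall>f\<in>smooth_fun M. \<forall>h\<in>smooth_fun M. v (f * h) = f p * v h + h p * v f) \<and>
     (\<forall>f. f \<notin> smooth_fun M \<longrightarrow> v f = 0)}"

definition vector_fields ::
    "('m::topological_space, 'e::euclidean_space) atlas \<Rightarrow> 'm vfield set" where
  "vector_fields M = {X. (\<forall>p. X p \<in> tangent_space M p) \<and>
                         (\<forall>f\<in>smooth_fun M. (\<lambda>p. X p f) \<in> smooth_fun M)}"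

definition lie_bracket :: "'m vfield \<Rightarrow> 'm vfield \<Rightarrow> 'm vfield" where
  "lie_bracket X Y = (\<lambda>p f. X p (\<lambda>q. Y q f) - Y p (\<lambda>q. X q f))"

definition pushforward ::
    "('n::topological_space, 'd::euclidean_space) atlas \<Rightarrow> ('m \<Rightarrow> 'n) \<Rightarrow> 'm tvec \<Rightarrow> 'n tvec" where
  "pushforward N \<pi> v = (\<lambda>h. if h \<in> smooth_fun N then v (h \<circ> \<pi>) else 0)"

text \<open>A smooth distribution of constant rank. Local frames consisting of local vector fields may
  be taken to consist of global ones after multiplication with a bump function.\<close>

definition smooth_distribution ::
    "('m::topological_space, 'e::euclidean_space) atlas \<Rightarrow> ('m \<Rightarrow> 'm tvec set) \<Rightarrow> bool" where
  "smooth_distribution M D \<longleftrightarrow>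
     (\<exists>k. \<forall>p. dim (D p) = k \<and>
        (\<exists>W X. open W \<and> p \<in> W \<and> (\<forall>i<k. X i \<in> vector_fields M) \<and>
               (\<forall>q\<in>W. D q = span ((\<lambda>i. X i q) ` {..<k}))))"

definition sections ::
    "('m::topological_space, 'e::euclidean_space) atlas \<Rightarrow> ('m \<Rightarrow> 'm tvec set) \<Rightarrow> 'm vfield set" where
  "sections M D = {X \<in> vector_fields M. \<forall>p. X p \<in> D p}"


section \<open>Riemannian and Kaehler metrics\<close>

type_synonym 'm metric = "'m \<Rightarrow> 'm tvec \<Rightarrow> 'm tvec \<Rightarrow> real"

definition riemannian_metric ::
    "('m::topological_space, 'e::euclidean_space) atlas \<Rightarrow> 'm metric \<Rightarrow> bool" where
  "riemannian_metric M g \<longleftrightarrow>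
     (\<forall>p. \<forall>u\<in>tangent_space M p. \<forall>v\<in>tangent_space M p. \<forall>w\<in>tangent_space M p. \<forall>c.
        g p (u + v) w = g p u w + g p v w \<and> g p (c *\<^sub>R u) w = c * g p u w \<and>
        g p u v = g p v u \<and> (u \<noteq> 0 \<longrightarrow> g p u u > 0)) \<and>
     (\<forall>X\<in>vector_fields M. \<forall>Y\<in>vector_fields M. (\<lambda>p. g p (X p) (Y p)) \<in> smooth_fun M)"

definition affine_connection ::
    "('m::topological_space, 'e::euclidean_space) atlas \<Rightarrow>
     ('m vfield \<Rightarrow> 'm vfield \<Rightarrow> 'm vfield) \<Rightarrow> bool" where
  "affine_connection M nabla \<longleftrightarrow>
     (\<forall>X\<in>vector_fields M. \<forall>Y\<in>vector_fields M. \<forall>Z\<in>vector_fields M. \<forall>f\<in>smooth_fun M.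
        nabla X Y \<in> vector_fields M \<and>
        nabla (X + Y) Z = nabla X Z + nabla Y Z \<and>
        nabla (\<lambda>p. f p *\<^sub>R X p) Z = (\<lambda>p. f p *\<^sub>R nabla X Z p) \<and>
        nabla X (Y + Z) = nabla X Y + nabla X Z \<and>
        nabla X (\<lambda>p. f p *\<^sub>R Y p) = (\<lambda>p. X p f *\<^sub>R Y p + f p *\<^sub>R nabla X Y p))"

definition levi_civita ::
    "('m::topological_space, 'e::euclidean_space) atlas \<Rightarrow> 'm metric \<Rightarrow>
     ('m vfield \<Rightarrow> 'm vfield \<Rightarrow> 'm vfield) \<Rightarrow> bool" where
  "levi_civita M g nabla \<longleftrightarrow>
     affine_connection M nabla \<and>
     (\<forall>X\<in>vector_fields M. \<forall>Y\<in>vector_fields M. nabla X Y - nabla Y X = lie_bracket X Y) \<and>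
     (\<forall>X\<in>vector_fields M. \<forall>Y\<in>vector_fields M. \<forall>Z\<in>vector_fields M. \<forall>p.
        X p (\<lambda>q. g q (Y q) (Z q)) = g p (nabla X Y p) (Z p) + g p (Y p) (nabla X Z p))"

definition almost_complex ::
    "('m::topological_space, 'e::euclidean_space) atlas \<Rightarrow> ('m \<Rightarrow> 'm tvec \<Rightarrow> 'm tvec) \<Rightarrow> bool" where
  "almost_complex M J \<longleftrightarrow>
     (\<forall>p. \<forall>u\<in>tangent_space M p. \<forall>v\<in>tangent_space M p. \<forall>c.
        J p u \<in> tangent_space M p \<and>
        J p (u + v) = J p u + J p v \<and> J p (c *\<^sub>R u) = c *\<^sub>R J p u \<and>
        J p (J p u) = - u) \<and>
     (\<forall>X\<in>vector_fields M. (\<lambda>p. J p (X p)) \<in> vector_fields M)"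

definition kaehler ::
    "('m::topological_space, 'e::euclidean_space) atlas \<Rightarrow> 'm metric \<Rightarrow>
     ('m \<Rightarrow> 'm tvec \<Rightarrow> 'm tvec) \<Rightarrow> ('m vfield \<Rightarrow> 'm vfield \<Rightarrow> 'm vfield) \<Rightarrow> bool" where
  "kaehler M g J nabla \<longleftrightarrow>
     riemannian_metric M g \<and> levi_civita M g nabla \<and> almost_complex M J \<and>
     (\<forall>p. \<forall>u\<in>tangent_space M p. \<forall>v\<in>tangent_space M p. g p (J p u) (J p v) = g p u v) \<and>
     (\<forall>X\<in>vector_fields M. \<forall>Y\<in>vector_fields M.
        nabla X (\<lambda>p. J p (Y p)) = (\<lambda>p. J p (nabla X Y p)))"


section \<open>Riemannian submersions and O'Neill's tensors\<close>

definition vertical_space ::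
    "('m::topological_space, 'e::euclidean_space) atlas \<Rightarrow>
     ('n::topological_space, 'd::euclidean_space) atlas \<Rightarrow> ('m \<Rightarrow> 'n) \<Rightarrow> 'm \<Rightarrow> 'm tvec set" where
  "vertical_space M N \<pi> p = {v \<in> tangent_space M p. pushforward N \<pi> v = 0}"

definition horizontal_space ::
    "('m::topological_space, 'e::euclidean_space) atlas \<Rightarrow> 'm metric \<Rightarrow>
     ('n::topological_space, 'd::euclidean_space) atlas \<Rightarrow> ('m \<Rightarrow> 'n) \<Rightarrow> 'm \<Rightarrow> 'm tvec set" where
  "horizontal_space M g N \<pi> p =
     {v \<in> tangent_space M p. \<forall>u\<in>vertical_space M N \<pi> p. g p v u = 0}"

definition riemannian_submersion ::
    "('m::topological_space, 'e::euclidean_space) atlas \<Rightarrow> 'm metric \<Rightarrow>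
     ('n::topological_space, 'd::euclidean_space) atlas \<Rightarrow> 'n metric \<Rightarrow> ('m \<Rightarrow> 'n) \<Rightarrow> bool" where
  "riemannian_submersion M g N g\<^sub>N \<pi> \<longleftrightarrow>
     DIM('e) > DIM('d) \<and> smooth_map M N \<pi> \<and> surj \<pi> \<and>
     (\<forall>p. pushforward N \<pi> ` tangent_space M p = tangent_space N (\<pi> p)) \<and>
     (\<forall>p. \<forall>u\<in>horizontal_space M g N \<pi> p. \<forall>v\<in>horizontal_space M g N \<pi> p.
        g\<^sub>N (\<pi> p) (pushforward N \<pi> u) (pushforward N \<pi> v) = g p u v)"

definition orth_proj :: "'m metric \<Rightarrow> 'm \<Rightarrow> 'm tvec set \<Rightarrow> 'm tvec \<Rightarrow> 'm tvec" where
  "orth_proj g p S v = (THE w. w \<in> S \<and> (\<forall>u\<in>S. g p (v - w) u = 0))"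

definition ver ::
    "('m::topological_space, 'e::euclidean_space) atlas \<Rightarrow> 'm metric \<Rightarrow>
     ('n::topological_space, 'd::euclidean_space) atlas \<Rightarrow> ('m \<Rightarrow> 'n) \<Rightarrow> 'm vfield \<Rightarrow> 'm vfield" where
  "ver M g N \<pi> E = (\<lambda>p. orth_proj g p (vertical_space M N \<pi> p) (E p))"

definition hor ::
    "('m::topological_space, 'e::euclidean_space) atlas \<Rightarrow> 'm metric \<Rightarrow>
     ('n::topological_space, 'd::euclidean_space) atlas \<Rightarrow> ('m \<Rightarrow> 'n) \<Rightarrow> 'm vfield \<Rightarrow> 'm vfield" where
  "hor M g N \<pi> E = (\<lambda>p. orth_proj g p (horizontal_space M g N \<pi> p) (E p))"

definition basic ::
    "('m::topological_space, 'e::euclidean_space) atlas \<Rightarrow> 'm metric \<Rightarrow>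
     ('n::topological_space, 'd::euclidean_space) atlas \<Rightarrow> ('m \<Rightarrow> 'n) \<Rightarrow> 'm vfield \<Rightarrow> bool" where
  "basic M g N \<pi> Y \<longleftrightarrow>
     Y \<in> sections M (horizontal_space M g N \<pi>) \<and>
     (\<exists>Z\<in>vector_fields N. \<forall>p. pushforward N \<pi> (Y p) = Z (\<pi> p))"

definition oneill_T ::
    "('m::topological_space, 'e::euclidean_space) atlas \<Rightarrow> 'm metric \<Rightarrow>
     ('m vfield \<Rightarrow> 'm vfield \<Rightarrow> 'm vfield) \<Rightarrow>
     ('n::topological_space, 'd::euclidean_space) atlas \<Rightarrow> ('m \<Rightarrow> 'n) \<Rightarrow>
     'm vfield \<Rightarrow> 'm vfield \<Rightarrow> 'm vfield" where
  "oneill_T M g nabla N \<pi> E G =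
     ver M g N \<pi> (nabla (ver M g N \<pi> E) (hor M g N \<pi> G)) +
     hor M g N \<pi> (nabla (ver M g N \<pi> E) (ver M g N \<pi> G))"

definition oneill_A ::
    "('m::topological_space, 'e::euclidean_space) atlas \<Rightarrow> 'm metric \<Rightarrow>
     ('m vfield \<Rightarrow> 'm vfield \<Rightarrow> 'm vfield) \<Rightarrow>
     ('n::topological_space, 'd::euclidean_space) atlas \<Rightarrow> ('m \<Rightarrow> 'n) \<Rightarrow>
     'm vfield \<Rightarrow> 'm vfield \<Rightarrow> 'm vfield" where
  "oneill_A M g nabla N \<pi> E G =
     ver M g N \<pi> (nabla (hor M g N \<pi> E) (hor M g N \<pi> G)) +
     hor M g N \<pi> (nabla (hor M g N \<pi> E) (ver M g N \<pi> G))"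

text \<open>The components \<open>P V\<close> and \<open>F V\<close> of \<open>J V\<close> for vertical \<open>V\<close>.\<close>

definition P_part ::
    "('m::topological_space, 'e::euclidean_space) atlas \<Rightarrow> 'm metric \<Rightarrow>
     ('m \<Rightarrow> 'm tvec \<Rightarrow> 'm tvec) \<Rightarrow>
     ('n::topological_space, 'd::euclidean_space) atlas \<Rightarrow> ('m \<Rightarrow> 'n) \<Rightarrow> 'm vfield \<Rightarrow> 'm vfield" where
  "P_part M g J N \<pi> V = ver M g N \<pi> (\<lambda>p. J p (V p))"

definition F_part ::
    "('m::topological_space, 'e::euclidean_space) atlas \<Rightarrow> 'm metric \<Rightarrow>
     ('m \<Rightarrow> 'm tvec \<Rightarrow> 'm tvec) \<Rightarrow>
     ('n::topological_space, 'd::euclidean_space) atlas \<Rightarrow> ('m \<Rightarrow> 'n) \<Rightarrow> 'm vfield \<Rightarrow> 'm vfield" where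
  "F_part M g J N \<pi> V = hor M g N \<pi> (\<lambda>p. J p (V p))"


section \<open>Bi-slant submersions\<close>

text \<open>The angle between a nonzero vector and a subspace is the one between the vector and its
  orthogonal projection, \<open>\<pi>/2\<close> if the projection vanishes.\<close>

definition angle_to_subspace :: "'m metric \<Rightarrow> 'm \<Rightarrow> 'm tvec \<Rightarrow> 'm tvec set \<Rightarrow> real" where
  "angle_to_subspace g p v S =
     arccos (sqrt (g p (orth_proj g p S v) (orth_proj g p S v)) / sqrt (g p v v))"

definition slant_distribution ::
    "('m::topological_space, 'e::euclidean_space) atlas \<Rightarrow> 'm metric \<Rightarrow>
     ('m \<Rightarrow> 'm tvec \<Rightarrow> 'm tvec) \<Rightarrow> ('m \<Rightarrow> 'm tvec set) \<Rightarrow> real \<Rightarrow> bool" where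
  "slant_distribution M g J D \<theta> \<longleftrightarrow>
     smooth_distribution M D \<and>
     (\<forall>p. \<forall>x\<in>D p. x \<noteq> 0 \<longrightarrow> angle_to_subspace g p (J p x) (D p) = \<theta>)"

text \<open>The direct sum is orthogonal.\<close>

definition bi_slant_submersion ::
    "('m::topological_space, 'e::euclidean_space) atlas \<Rightarrow> 'm metric \<Rightarrow>
     ('m \<Rightarrow> 'm tvec \<Rightarrow> 'm tvec) \<Rightarrow>
     ('n::topological_space, 'd::euclidean_space) atlas \<Rightarrow> 'n metric \<Rightarrow> ('m \<Rightarrow> 'n) \<Rightarrow>
     ('m \<Rightarrow> 'm tvec set) \<Rightarrow> real \<Rightarrow> ('m \<Rightarrow> 'm tvec set) \<Rightarrow> real \<Rightarrow> bool" where
  "bi_slant_submersion M g J N g\<^sub>N \<pi> D\<^sub>1 \<theta>\<^sub>1 D\<^sub>2 \<theta>\<^sub>2 \<longleftrightarrow>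
     riemannian_submersion M g N g\<^sub>N \<pi> \<and>
     slant_distribution M g J D\<^sub>1 \<theta>\<^sub>1 \<and> slant_distribution M g J D\<^sub>2 \<theta>\<^sub>2 \<and>
     (\<forall>p. vertical_space M N \<pi> p = {u + w |u w. u \<in> D\<^sub>1 p \<and> w \<in> D\<^sub>2 p} \<and>
          (\<forall>u\<in>D\<^sub>1 p. \<forall>w\<in>D\<^sub>2 p. g p u w = 0))"

text \<open>Rendering, for the horizontal fields \<open>F V\<close> with \<open>V\<close> in a vertical distribution \<open>D\<close>, of the
  convention that horizontal fields are assumed to be basic. It cannot be imposed on all sections
  \<open>V\<close> of \<open>D\<close>, since \<open>F (f V) = f F V\<close> is not basic if \<open>F V\<close> is basic and nonzero and the smooth
  function \<open>f\<close> is not constant on the fibres. So it is required that the sections \<open>V\<close> for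
  which \<open>F V\<close> is basic near a given point \<open>p\<close> realise all vectors of \<open>D p\<close>.\<close>

definition basic_F_part ::
    "('m::topological_space, 'e::euclidean_space) atlas \<Rightarrow> 'm metric \<Rightarrow>
     ('m \<Rightarrow> 'm tvec \<Rightarrow> 'm tvec) \<Rightarrow>
     ('n::topological_space, 'd::euclidean_space) atlas \<Rightarrow> ('m \<Rightarrow> 'n) \<Rightarrow>
     ('m \<Rightarrow> 'm tvec set) \<Rightarrow> bool" where
  "basic_F_part M g J N \<pi> D \<longleftrightarrow>
     (\<forall>p. \<forall>v\<in>D p. \<exists>V\<in>sections M D. V p = v \<and>
        (\<exists>Y W. basic M g N \<pi> Y \<and> open W \<and> p \<in> W \<and> (\<forall>q\<in>W. F_part M g J N \<pi> V q = Y q)))"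

definition vertical_totally_geodesic ::
    "('m::topological_space, 'e::euclidean_space) atlas \<Rightarrow> 'm metric \<Rightarrow>
     ('m vfield \<Rightarrow> 'm vfield \<Rightarrow> 'm vfield) \<Rightarrow>
     ('n::topological_space, 'd::euclidean_space) atlas \<Rightarrow> ('m \<Rightarrow> 'n) \<Rightarrow>
     ('m \<Rightarrow> 'm tvec set) \<Rightarrow> bool" where
  "vertical_totally_geodesic M g nabla N \<pi> D \<longleftrightarrow>
     (\<forall>U\<in>sections M D. \<forall>V\<in>sections M D. ver M g N \<pi> (nabla U V) \<in> sections M D)"

end

theory Submission
  imports Defs "HOL-Computational_Algebra.Polynomial"
begin

text \<open>Let \<open>c = cos\<^sup>2 \<theta>\<^sub>2\<close>, so that \<open>P\<^sup>2 = - c\<close> on \<open>D\<^sub>2\<close>. Applying \<open>J\<close> twice in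
  \<open>g (\<nabla>\<^sub>U V, X) = g (\<nabla>\<^sub>U J V, J X)\<close> and splitting \<open>J = P + F\<close> gives
  \<open>(1 - c) g (\<nabla>\<^sub>U V, X) = g (\<nabla>\<^sub>U F V, P X) - g (\<nabla>\<^sub>U F P V, X) + g (\<nabla>\<^sub>U F V, F X)\<close>.
  Since brackets of vertical fields are vertical, the first two terms on the right are
  \<open>g (T\<^bsub>P X\<^esub> F V, U)\<close> and \<open>- g (T\<^sub>X F P V, U)\<close>. The last one equals \<open>g (A\<^bsub>F X\<^esub> F V, U)\<close>: because \<open>F V\<close>
  and \<open>F X\<close> are orthogonal, both depend only on the values of \<open>V\<close> and \<open>X\<close> at the point, so
  \<open>F V\<close> and \<open>F X\<close> may be assumed to be basic. Finally \<open>c \<noteq> 1\<close> as \<open>\<theta>\<^sub>2 \<noteq> 0\<close>.\<close>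


section \<open>Smooth functions on open sets\<close>

text \<open>Two assumptions beyond the slant conditions shape the argument. Orthogonality of
  \<open>J D\<^sub>1\<close> and \<open>D\<^sub>2\<close> makes \<open>P\<close> preserve both
  distributions, so that \<open>P\<close> on \<open>D\<^sub>2\<close> is the projection measured by
  the slant angle, and it makes \<open>F V\<close> and \<open>F X\<close> orthogonal. The basic
  convention holds only for some sections through each vector; \<open>g (F V, F X) = 0\<close>
  repairs this by turning \<open>g (\<nabla>\<^sub>U F V, F X)\<close> into
  \<open>- g (F V, \<nabla>\<^sub>U F X)\<close>, which sees \<open>V\<close> only at the point. The
  analytic obstacle is that \<open>nabla\<close> acts on global fields, while frames of a
  distribution and agreement with a basic field are local. Locality and dependence on point values
  therefore have to be derived from bump functions and from a Gram-Schmidt process that produces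
  global fields. Smoothness of vertical and horizontal parts is not assumed either; it comes from
  the orthogonal splitting of the vertical spaces into \<open>D\<^sub>1\<close> and
  \<open>D\<^sub>2\<close>.\<close>

lemma ck_on_subset: "ck_on k S f \<Longrightarrow> T \<subseteq> S \<Longrightarrow> ck_on k T f"
  by (induction k arbitrary: f) (auto intro: continuous_on_subset)

text \<open>The derivative at a point of \<open>S\<close> only sees a neighbourhood, which can be
  taken inside \<open>S\<close> because \<open>S\<close> is open. This is why openness recurs in the
  rules below.\<close>

lemma ck_on_cong:
  assumes "open S" "\<And>x. x \<in> S \<Longrightarrow> f x = h x" "ck_on k S f"
  shows "ck_on k S h"
  using assms(2,3)
proof (induction k arbitrary: f h)
  case 0
  then show ?case by (auto cong: continuous_on_cong)
next
  case (Suc k)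
  have d: "(h has_derivative frechet_derivative f (at x)) (at x)" if "x \<in> S" for x
    using that Suc.prems assms(1)
    by (metis ck_on.simps(2) frechet_derivative_works has_derivative_transform_within_open)
  then have "frechet_derivative h (at x) = frechet_derivative f (at x)" if "x \<in> S" for x
    using that by (metis frechet_derivative_at)
  then have "ck_on k S (\<lambda>x. frechet_derivative h (at x) v)" for v
    using Suc.IH[of "\<lambda>x. frechet_derivative f (at x) v" "\<lambda>x. frechet_derivative h (at x) v"] Suc.prems(2)
    by auto
  then show ?case using d by (auto simp: differentiable_def)
qed

text \<open>Lets an induction on \<open>k\<close> work with an explicit derivative \<open>f'\<close>
  in place of the abstract \<open>frechet_derivative\<close>.\<close>

lemma ck_on_SucI:
  assumes "open S" "\<And>x. x \<in> S \<Longrightarrow> (f has_derivative f' x) (at x)"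
    "\<And>v. ck_on k S (\<lambda>x. f' x v)"
  shows "ck_on (Suc k) S f"
proof -
  have "frechet_derivative f (at x) = f' x" if "x \<in> S" for x
    using assms(2)[OF that] by (metis frechet_derivative_at)
  then have "ck_on k S (\<lambda>x. frechet_derivative f (at x) v)" for v
    using ck_on_cong[OF assms(1) _ assms(3)[of v]] by auto
  then show ?thesis using assms(2) by (auto simp: differentiable_def)
qed

lemma ck_on_SucD: "ck_on (Suc k) S f \<Longrightarrow> ck_on k S f"
proof (induction k arbitrary: f)
  case 0
  then show ?case
    by (auto intro!: continuous_at_imp_continuous_on differentiable_imp_continuous_within)
next
  case (Suc k)
  show ?case unfolding ck_on.simps(2)[of k] using Suc.prems Suc.IH by (metis ck_on.simps(2))
qed

lemma ck_on_local:
  assumes "\<And>x. x \<in> S \<Longrightarrow> \<exists>T. open T \<and> x \<in> T \<and> ck_on k T f"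
  shows "ck_on k S f"
  using assms
proof (induction k arbitrary: f)
  case 0
  show ?case unfolding ck_on.simps
    by (intro continuous_at_imp_continuous_on ballI)
      (metis 0 ck_on.simps(1) continuous_on_eq_continuous_at)
next
  case (Suc k)
  have "f differentiable at x" if "x \<in> S" for x
    using Suc.prems[OF that] by auto
  moreover have "ck_on k S (\<lambda>x. frechet_derivative f (at x) v)" for v
    by (rule Suc.IH) (metis Suc.prems ck_on.simps(2))
  ultimately show ?case by auto
qed

lemma ck_on_const: "ck_on k S (\<lambda>x. c)"
  by (induction k arbitrary: c) (auto simp: frechet_derivative_const)

lemma ck_on_add:
  assumes "open S" "ck_on k S f" "ck_on k S h"
  shows "ck_on k S (\<lambda>x. f x + h x)"
  using assms(2,3)
proof (induction k arbitrary: f h)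
  case 0
  then show ?case by (auto intro: continuous_on_add)
next
  case (Suc k)
  show ?case
  proof (rule ck_on_SucI[OF assms(1)])
    fix x assume "x \<in> S"
    then show "((\<lambda>x. f x + h x) has_derivative
        (\<lambda>v. frechet_derivative f (at x) v + frechet_derivative h (at x) v)) (at x)"
      using Suc.prems by (intro has_derivative_add) (auto simp flip: frechet_derivative_works)
  qed (use Suc in auto)
qed

text \<open>In each summand of the Leibniz rule one factor is a derivative and the other keeps its
  full order, which \<open>ck_on_SucD\<close> lowers to match. The bilinear map is left general to
  cover products and inner products alike.\<close>

lemma (in bounded_bilinear) ck_on_prod:
  assumes "open S" "ck_on k S f" "ck_on k S h"
  shows "ck_on k S (\<lambda>x. prod (f x) (h x))"
  using assms(2,3)
proof (induction k arbitrary: f h)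
  case 0
  then show ?case by (auto intro: continuous_on)
next
  case (Suc k)
  show ?case
  proof (rule ck_on_SucI[OF assms(1)])
    fix x assume "x \<in> S"
    then show "((\<lambda>x. prod (f x) (h x)) has_derivative
        (\<lambda>v. prod (f x) (frechet_derivative h (at x) v) + prod (frechet_derivative f (at x) v) (h x))) (at x)"
      using Suc.prems by (intro FDERIV) (auto simp flip: frechet_derivative_works)
  next
    fix v
    show "ck_on k S (\<lambda>x. prod (f x) (frechet_derivative h (at x) v) +
        prod (frechet_derivative f (at x) v) (h x))"
      using Suc.prems ck_on_SucD[OF Suc.prems(1)] ck_on_SucD[OF Suc.prems(2)]
      by (intro ck_on_add[OF assms(1)] Suc.IH) auto
  qed
qed

text \<open>All derivatives of \<open>B 0\<close> are given at once: differentiating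
  \<open>B n \<circ> u\<close> produces \<open>B (Suc n) \<circ> u\<close> times a derivative of
  \<open>u\<close>, so the induction only has to generalise over \<open>n\<close>.\<close>

lemma ck_on_compose_real:
  fixes B :: "nat \<Rightarrow> real \<Rightarrow> real"
  assumes "open S" "\<And>n t. t \<in> T \<Longrightarrow> (B n has_real_derivative B (Suc n) t) (at t)"
    "\<And>x. x \<in> S \<Longrightarrow> u x \<in> T" "ck_on k S u"
  shows "ck_on k S (\<lambda>x. B n (u x))"
  using assms(4)
proof (induction k arbitrary: n)
  case 0
  have "continuous_on T (B n)"
    using assms(2) by (intro continuous_at_imp_continuous_on) (auto intro: DERIV_isCont)
  then show ?case using 0 assms(3)
    by (auto intro: continuous_on_compose2)
next
  case (Suc k)
  show ?case
  proof (rule ck_on_SucI[OF assms(1)])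
    fix x assume x: "x \<in> S"
    have "(u has_derivative frechet_derivative u (at x)) (at x)"
      using Suc.prems x by (auto simp flip: frechet_derivative_works)
    moreover have "(B n has_derivative (\<lambda>h. B (Suc n) (u x) * h)) (at (u x))"
      using assms(2)[OF assms(3)[OF x]] by (simp add: has_field_derivative_def)
    ultimately show "((\<lambda>x. B n (u x)) has_derivative
        (\<lambda>v. B (Suc n) (u x) * frechet_derivative u (at x) v)) (at x)"
      using has_derivative_compose[of u _ x UNIV "B n"] by simp
  next
    fix v
    show "ck_on k S (\<lambda>x. B (Suc n) (u x) * frechet_derivative u (at x) v)"
      using Suc ck_on_SucD[OF Suc.prems]
      by (intro bounded_bilinear.ck_on_prod[OF bounded_bilinear_mult] assms(1)) auto
  qed
qed

lemma smooth_on_inverse: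
  assumes "open S" "smooth_on S u" "\<And>x. x \<in> S \<Longrightarrow> u x \<noteq> (0::real)"
  shows "smooth_on S (\<lambda>x. inverse (u x))"
proof -
  \<comment> \<open>\<open>B n\<close> is the \<open>n\<close>-th derivative of
    \<open>1/t\<close>.\<close>
  define B :: "nat \<Rightarrow> real \<Rightarrow> real" where "B = (\<lambda>n t. (-1)^n * fact n * inverse t ^ Suc n)"
  have "(B n has_real_derivative B (Suc n) t) (at t)" if "t \<in> - {0}" for n t
    unfolding B_def
    by (rule DERIV_cmult[OF DERIV_power_Suc[OF DERIV_inverse], THEN DERIV_cong])
      (use that in \<open>auto simp: algebra_simps\<close>)
  from ck_on_compose_real[of S "-{0}" B u _ 0, OF assms(1) this] assms show ?thesis
    by (auto simp: smooth_on_def B_def)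
qed

text \<open>The derivatives of \<open>exp (- 1/t)\<close> extended by 0 to \<open>t \<le> 0\<close>.\<close>

fun bump_poly :: "nat \<Rightarrow> real poly" where
  "bump_poly 0 = 1"
| "bump_poly (Suc n) = [:0, 0, 1:] * (bump_poly n - pderiv (bump_poly n))"

definition bump_deriv :: "nat \<Rightarrow> real \<Rightarrow> real" where
  "bump_deriv n t = (if t > 0 then poly (bump_poly n) (1 / t) * exp (- (1 / t)) else 0)"

lemma poly_times_exp_tendsto_0: "((\<lambda>s. poly p s * exp (- s)) \<longlongrightarrow> (0::real)) at_top"
proof -
  have "((\<lambda>s. \<Sum>i\<le>degree p. coeff p i * (s ^ i / exp s)) \<longlongrightarrow> (\<Sum>i\<le>degree p. coeff p i * 0)) at_top"
    by (intro tendsto_intros tendsto_power_div_exp_0)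
  then show ?thesis
    by (simp add: poly_altdef exp_minus divide_inverse sum_distrib_right mult.assoc)
qed

text \<open>For \<open>t > 0\<close> put \<open>s = 1/t\<close>: the derivative of
  \<open>p(s) exp (- s)\<close> with respect to \<open>t\<close> is
  \<open>s\<^sup>2 (p - p')(s) exp (- s)\<close>, which is the recursion of
  \<open>bump_poly\<close>, the factor \<open>s\<^sup>2\<close> being \<open>[:0, 0, 1:]\<close>. At
  \<open>0\<close> exponential decay beats every polynomial.\<close>

lemma bump_deriv_derivative: "(bump_deriv n has_real_derivative bump_deriv (Suc n) t) (at t)"
proof -
  consider "t > 0" | "t < 0" | "t = 0" by linarith
  then show ?thesis
  proof cases
    case 1
    have "((\<lambda>t. poly (bump_poly n) (1 / t) * exp (- (1 / t))) has_real_derivative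
        bump_deriv (Suc n) t) (at t)"
      using 1 by (auto intro!: derivative_eq_intros DERIV_chain2[OF poly_DERIV]
          simp: bump_deriv_def field_simps power2_eq_square)
    then show ?thesis
      by (rule has_field_derivative_transform_within_open[of _ _ _ "{0<..}"])
        (use 1 in \<open>auto simp: bump_deriv_def\<close>)
  next
    case 2
    have "((\<lambda>t. 0) has_real_derivative bump_deriv (Suc n) t) (at t)"
      using 2 by (auto simp: bump_deriv_def)
    then show ?thesis
      by (rule has_field_derivative_transform_within_open[of _ _ _ "{..<0}"])
        (use 2 in \<open>auto simp: bump_deriv_def\<close>)
  next
    case 3
    \<comment> \<open>With \<open>s = inverse t\<close> the difference quotient at \<open>0\<close>
      is \<open>s * p s * exp (- s)\<close>; \<open>pCons 0\<close> supplies the extra factor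
      \<open>s\<close>.\<close>
    have "((\<lambda>t. poly (pCons 0 (bump_poly n)) (inverse t) * exp (- inverse t)) \<longlongrightarrow> 0) (at_right 0)"
      by (rule filterlim_compose[OF poly_times_exp_tendsto_0 filterlim_inverse_at_top_right])
    then have "((\<lambda>t. bump_deriv n t / t) \<longlongrightarrow> 0) (at_right 0)"
      by (rule Lim_transform_eventually)
        (auto simp: eventually_at_right_less bump_deriv_def field_simps
          intro!: eventually_mono[OF eventually_at_right_less])
    moreover have "((\<lambda>t. bump_deriv n t / t) \<longlongrightarrow> 0) (at_left 0)"
      by (rule Lim_transform_eventually[OF tendsto_const])
        (auto simp: bump_deriv_def eventually_at_left_field intro!: exI[of _ "-1"])
    ultimately have "((\<lambda>t. bump_deriv n t / t) \<longlongrightarrow> 0) (at 0)"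
      by (simp add: filterlim_split_at)
    then show ?thesis using 3 by (simp add: has_field_derivative_iff bump_deriv_def)
  qed
qed


section \<open>Smooth functions and vector fields on a manifold\<close>

lemma smooth_on_add: "open S \<Longrightarrow> smooth_on S f \<Longrightarrow> smooth_on S h \<Longrightarrow> smooth_on S (\<lambda>x. f x + h x)"
  by (simp add: smooth_on_def ck_on_add)

lemma smooth_on_mult:
  fixes f h :: "'a::real_normed_vector \<Rightarrow> real"
  shows "open S \<Longrightarrow> smooth_on S f \<Longrightarrow> smooth_on S h \<Longrightarrow> smooth_on S (\<lambda>x. f x * h x)"
  by (simp add: smooth_on_def bounded_bilinear.ck_on_prod[OF bounded_bilinear_mult])

lemma smooth_on_inner:
  "open S \<Longrightarrow> smooth_on S f \<Longrightarrow> smooth_on S h \<Longrightarrow> smooth_on S (\<lambda>x. f x \<bullet> h x)"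
  by (simp add: smooth_on_def bounded_bilinear.ck_on_prod[OF bounded_bilinear_inner])

lemma smooth_on_const: "smooth_on S (\<lambda>x. c)"
  by (simp add: smooth_on_def ck_on_const)

lemma smooth_on_cong: "open S \<Longrightarrow> (\<And>x. x \<in> S \<Longrightarrow> f x = h x) \<Longrightarrow> smooth_on S f \<Longrightarrow> smooth_on S h"
  unfolding smooth_on_def using ck_on_cong by blast

lemma smooth_on_subset: "smooth_on S f \<Longrightarrow> T \<subseteq> S \<Longrightarrow> smooth_on T f"
  unfolding smooth_on_def using ck_on_subset by blast

lemma smooth_on_local:
  "(\<And>x. x \<in> S \<Longrightarrow> \<exists>T. open T \<and> x \<in> T \<and> smooth_on T f) \<Longrightarrow> smooth_on S f"
  unfolding smooth_on_def by (meson ck_on_local)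

text \<open>Reciprocals of squared lengths of frame fields are smooth only where the frame does not
  vanish, although they are total functions; hence a notion of smoothness relative to
  \<open>W\<close>.\<close>

definition smooth_fun_on ::
    "('m::topological_space, 'e::euclidean_space) atlas \<Rightarrow> 'm set \<Rightarrow> ('m \<Rightarrow> real) set" where
  "smooth_fun_on M W = {f. \<forall>(U, \<phi>)\<in>M. smooth_on (\<phi> ` (U \<inter> W)) (f \<circ> inv_into U \<phi>)}"

lemma smooth_fun_on_UNIV: "smooth_fun_on M UNIV = smooth_fun M"
  by (simp add: smooth_fun_on_def smooth_fun_def)

lemma smooth_fun_on_subset: "f \<in> smooth_fun_on M W \<Longrightarrow> V \<subseteq> W \<Longrightarrow> f \<in> smooth_fun_on M V"
  unfolding smooth_fun_on_def by (fast intro: smooth_on_subset)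

lemma smooth_fun_imp_on: "f \<in> smooth_fun M \<Longrightarrow> f \<in> smooth_fun_on M W"
  by (metis smooth_fun_on_UNIV smooth_fun_on_subset top_greatest)

section \<open>Localised smoothness and bump functions\<close>

locale smooth_manifold =
  fixes M :: "('m::{t2_space,second_countable_topology}, 'e::euclidean_space) atlas"
  assumes atlas: "smooth_atlas M"
begin

lemma chart_homeomorphism:
  "(U, \<phi>) \<in> M \<Longrightarrow> open U \<and> open (\<phi> ` U) \<and> homeomorphism U (\<phi> ` U) \<phi> (inv_into U \<phi>)"
  using atlas unfolding smooth_atlas_def by fast

lemma open_chart_image:
  assumes "(U, \<phi>) \<in> M" "open W"
  shows "open (\<phi> ` (U \<inter> W))"
proof -
  have "openin (top_of_set (\<phi> ` U)) (\<phi> ` (U \<inter> W))"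
    using chart_homeomorphism[OF assms(1)] assms(2)
    by (intro homeomorphism_imp_open_map) (auto simp: openin_open_Int)
  then show ?thesis
    using chart_homeomorphism[OF assms(1)] openin_open_trans by blast
qed

lemma inv_into_chart: "(U, \<phi>) \<in> M \<Longrightarrow> q \<in> U \<Longrightarrow> inv_into U \<phi> (\<phi> q) = q"
  using chart_homeomorphism homeomorphism_apply1 by blast

lemma chart_at: obtains U \<phi> where "(U, \<phi>) \<in> M" "p \<in> U"
  using atlas unfolding smooth_atlas_def by fast

lemma smooth_fun_on_add:
  "open W \<Longrightarrow> f \<in> smooth_fun_on M W \<Longrightarrow> h \<in> smooth_fun_on M W \<Longrightarrow> (\<lambda>x. f x + h x) \<in> smooth_fun_on M W"
  unfolding smooth_fun_on_def comp_def using open_chart_image smooth_on_add by fast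

lemma smooth_fun_on_mult:
  "open W \<Longrightarrow> f \<in> smooth_fun_on M W \<Longrightarrow> h \<in> smooth_fun_on M W \<Longrightarrow> (\<lambda>x. f x * h x) \<in> smooth_fun_on M W"
  unfolding smooth_fun_on_def comp_def using open_chart_image smooth_on_mult by fast

lemma smooth_fun_on_const: "(\<lambda>x. c) \<in> smooth_fun_on M W"
  unfolding smooth_fun_on_def comp_def using smooth_on_const by fast

lemma smooth_fun_on_inverse:
  assumes "open W" "f \<in> smooth_fun_on M W" "\<And>x. x \<in> W \<Longrightarrow> f x \<noteq> 0"
  shows "(\<lambda>x. inverse (f x)) \<in> smooth_fun_on M W"
proof -
  have "smooth_on (\<phi> ` (U \<inter> W)) (\<lambda>x. inverse (f (inv_into U \<phi> x)))" if "(U, \<phi>) \<in> M" for U \<phi>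
    using assms that inv_into_chart[OF that]
    by (intro smooth_on_inverse open_chart_image) (auto simp: smooth_fun_on_def comp_def)
  then show ?thesis by (auto simp: smooth_fun_on_def comp_def)
qed

lemma smooth_fun_on_cong:
  assumes "open W" "f \<in> smooth_fun_on M W" "\<And>x. x \<in> W \<Longrightarrow> f x = h x"
  shows "h \<in> smooth_fun_on M W"
proof -
  have "smooth_on (\<phi> ` (U \<inter> W)) (h \<circ> inv_into U \<phi>)" if "(U, \<phi>) \<in> M" for U \<phi>
    using assms that inv_into_chart[OF that]
    by (intro smooth_on_cong[of _ "f \<circ> inv_into U \<phi>" "h \<circ> inv_into U \<phi>"] open_chart_image)
      (auto simp: smooth_fun_on_def)
  then show ?thesis by (auto simp: smooth_fun_on_def)
qed

lemma smooth_fun_on_local: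
  assumes "\<And>p. p \<in> W \<Longrightarrow> \<exists>V. open V \<and> p \<in> V \<and> f \<in> smooth_fun_on M V"
  shows "f \<in> smooth_fun_on M W"
proof -
  have "smooth_on (\<phi> ` (U \<inter> W)) (f \<circ> inv_into U \<phi>)" if M: "(U, \<phi>) \<in> M" for U \<phi>
  proof (rule smooth_on_local)
    fix y assume "y \<in> \<phi> ` (U \<inter> W)"
    then obtain q where q: "q \<in> U" "q \<in> W" "y = \<phi> q" by auto
    then obtain V where "open V" "q \<in> V" "f \<in> smooth_fun_on M V" using assms by metis
    then show "\<exists>T. open T \<and> y \<in> T \<and> smooth_on T (f \<circ> inv_into U \<phi>)"
      using q M open_chart_image[OF M]
      by (intro exI[of _ "\<phi> ` (U \<inter> V)"]) (auto simp: smooth_fun_on_def)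
  qed
  then show ?thesis by (auto simp: smooth_fun_on_def)
qed


lemma smooth_fun_add: "f \<in> smooth_fun M \<Longrightarrow> h \<in> smooth_fun M \<Longrightarrow> (\<lambda>x. f x + h x) \<in> smooth_fun M"
  and smooth_fun_mult: "f \<in> smooth_fun M \<Longrightarrow> h \<in> smooth_fun M \<Longrightarrow> (\<lambda>x. f x * h x) \<in> smooth_fun M"
  and smooth_fun_const: "(\<lambda>x. c) \<in> smooth_fun M"
  using smooth_fun_on_add[of UNIV] smooth_fun_on_mult[of UNIV] smooth_fun_on_const[of c UNIV]
  by (auto simp: smooth_fun_on_UNIV)

lemma smooth_fun_diff: "f \<in> smooth_fun M \<Longrightarrow> h \<in> smooth_fun M \<Longrightarrow> (\<lambda>x. f x - h x) \<in> smooth_fun M"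
  using smooth_fun_add[OF _ smooth_fun_mult[OF smooth_fun_const[of "-1"]]] by simp

lemma smooth_fun_prod:
  "(\<And>i. i \<in> I \<Longrightarrow> f i \<in> smooth_fun M) \<Longrightarrow> (\<lambda>x. \<Prod>i\<in>I. f i x) \<in> smooth_fun M"
  by (induction I rule: infinite_finite_induct) (auto intro: smooth_fun_const smooth_fun_mult)

text \<open>Cuts local data off to global ones, on which \<open>nabla\<close> can act. A nonzero
  value at \<open>p\<close> is as good as the value \<open>1\<close>, since it can be divided out at
  \<open>p\<close>.\<close>

lemma bump_function:
  assumes "open W" "p \<in> W"
  obtains \<beta> where "\<beta> \<in> smooth_fun M" "\<beta> p \<noteq> 0" "\<And>q. q \<notin> W \<Longrightarrow> \<beta> q = 0"
proof -
  obtain U \<phi> where M: "(U, \<phi>) \<in> M" and p: "p \<in> U" by (rule chart_at)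
  obtain r where r: "r > 0" "cball (\<phi> p) r \<subseteq> \<phi> ` (U \<inter> W)"
    using open_chart_image[OF M assms(1)] p assms(2) open_contains_cball by (metis IntI imageI)
  \<comment> \<open>\<open>K\<close> is compact, hence closed because the manifold is Hausdorff. So
    \<open>U\<close> and \<open>- K\<close> form an open cover, and \<open>\<beta>\<close> is smooth
    on each of the two.\<close>
  define K where "K = inv_into U \<phi> ` cball (\<phi> p) r"
  \<comment> \<open>The profile \<open>exp (- 1/t)\<close> at
    \<open>t = r\<^sup>2 - |\<phi> q - \<phi> p|\<^sup>2\<close>, which is positive exactly on the
    open chart ball.\<close>
  define \<beta> where "\<beta> q = (if q \<in> U then bump_deriv 0 (r\<^sup>2 + (-1) * ((\<phi> q + - \<phi> p) \<bullet> (\<phi> q + - \<phi> p))) else 0)" for q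
  have "continuous_on (cball (\<phi> p) r) (inv_into U \<phi>)"
    using chart_homeomorphism[OF M] r(2) by (auto simp: homeomorphism_def intro: continuous_on_subset)
  then have "closed K" unfolding K_def by (intro compact_imp_closed compact_continuous_image) auto
  have KW: "K \<subseteq> U \<inter> W" using r(2) inv_into_chart[OF M] unfolding K_def by auto
  have out: "\<beta> q = 0" if "q \<notin> K" for q
  proof (rule ccontr)
    assume "\<beta> q \<noteq> 0"
    then have q: "q \<in> U" "(norm (\<phi> q - \<phi> p))\<^sup>2 < r\<^sup>2"
      by (auto simp: \<beta>_def bump_deriv_def power2_norm_eq_inner split: if_splits)
    then have "\<phi> q \<in> cball (\<phi> p) r"
      using r(1) by (auto simp: dist_norm norm_minus_commute dest!: power2_less_imp_less)
    then have "q \<in> K" using q(1) inv_into_chart[OF M] unfolding K_def by force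
    then show False using that by simp
  qed
  have "\<beta> \<in> smooth_fun_on M U"
  proof -
    have "smooth_on (\<psi> ` (Q \<inter> U)) (\<beta> \<circ> inv_into Q \<psi>)" if Q: "(Q, \<psi>) \<in> M" for Q \<psi>
    proof -
      let ?S = "\<psi> ` (Q \<inter> U)" and ?\<tau> = "\<phi> \<circ> inv_into Q \<psi>"
      have S: "open ?S" using open_chart_image[OF Q] chart_homeomorphism[OF M] by simp
      have "smooth_on ?S ?\<tau>" using atlas M Q unfolding smooth_atlas_def by fast
      then have "smooth_on ?S (\<lambda>y. r\<^sup>2 + (-1) * ((?\<tau> y + - \<phi> p) \<bullet> (?\<tau> y + - \<phi> p)))"
        by (intro smooth_on_add smooth_on_mult smooth_on_inner smooth_on_const S)
      then have "smooth_on ?S (\<lambda>y. bump_deriv 0 (r\<^sup>2 + (-1) * ((?\<tau> y + - \<phi> p) \<bullet> (?\<tau> y + - \<phi> p))))"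
        unfolding smooth_on_def
        by (intro allI ck_on_compose_real[of _ UNIV bump_deriv] S bump_deriv_derivative) auto
      then show ?thesis
        by (rule smooth_on_cong[OF S, rotated]) (use inv_into_chart[OF Q] in \<open>auto simp: \<beta>_def\<close>)
    qed
    then show ?thesis by (auto simp: smooth_fun_on_def)
  qed
  moreover have "\<beta> \<in> smooth_fun_on M (- K)"
    by (rule smooth_fun_on_cong[OF _ smooth_fun_on_const[of 0]]) (use \<open>closed K\<close> out in auto)
  moreover have "q \<in> U \<or> q \<in> - K" for q using KW by auto
  ultimately have "\<beta> \<in> smooth_fun M"
    using smooth_fun_on_local[of UNIV \<beta>] chart_homeomorphism[OF M] \<open>closed K\<close>
    unfolding smooth_fun_on_UNIV by (metis open_Compl)
  moreover have "\<beta> p \<noteq> 0" using p r(1) by (simp add: \<beta>_def bump_deriv_def)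
  moreover have "\<beta> q = 0" if "q \<notin> W" for q using out KW that by auto
  ultimately show thesis using that by blast
qed

section \<open>Tangent vectors and the module of vector fields\<close>

lemma tangent_scale: "v \<in> tangent_space M p \<Longrightarrow> f \<in> smooth_fun M \<Longrightarrow> v (\<lambda>x. c * f x) = c * v f"
  and tangent_mult: "v \<in> tangent_space M p \<Longrightarrow> f \<in> smooth_fun M \<Longrightarrow> h \<in> smooth_fun M \<Longrightarrow>
    v (\<lambda>x. f x * h x) = f p * v h + h p * v f"
  unfolding tangent_space_def times_fun_def scaleR_fun_def by simp_all

lemma tangent_zero_fun: "v \<in> tangent_space M p \<Longrightarrow> v (\<lambda>x. 0) = 0"
  using tangent_scale[of v p "\<lambda>x. 0" 0] smooth_fun_const[of 0] by simp

lemma subspace_tangent_space: "subspace (tangent_space M p)"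
  unfolding subspace_def tangent_space_def
  by (auto simp: plus_fun_def scaleR_fun_def zero_fun_def algebra_simps)

lemma vector_field_tangent: "X \<in> vector_fields M \<Longrightarrow> X p \<in> tangent_space M p"
  and vector_field_smooth: "X \<in> vector_fields M \<Longrightarrow> f \<in> smooth_fun M \<Longrightarrow> (\<lambda>p. X p f) \<in> smooth_fun M"
  by (auto simp: vector_fields_def)

lemma vector_field_add: "X \<in> vector_fields M \<Longrightarrow> Y \<in> vector_fields M \<Longrightarrow> X + Y \<in> vector_fields M"
  using subspace_add[OF subspace_tangent_space]
  by (auto simp: vector_fields_def plus_fun_def intro: smooth_fun_add)

lemma vector_field_scale:
  "X \<in> vector_fields M \<Longrightarrow> f \<in> smooth_fun M \<Longrightarrow> (\<lambda>p. f p *\<^sub>R X p) \<in> vector_fields M"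
  using subspace_scale[OF subspace_tangent_space]
  by (auto simp: vector_fields_def scaleR_fun_def intro: smooth_fun_mult)

lemma vector_field_zero: "0 \<in> vector_fields M"
  using subspace_0[OF subspace_tangent_space]
  by (auto simp: vector_fields_def zero_fun_def intro: smooth_fun_const)

lemma vector_field_diff: "X \<in> vector_fields M \<Longrightarrow> Y \<in> vector_fields M \<Longrightarrow> X - Y \<in> vector_fields M"
  using subspace_diff[OF subspace_tangent_space]
  by (auto simp: vector_fields_def fun_diff_def intro: smooth_fun_diff)

lemma vector_field_sum:
  "(\<And>i. i \<in> I \<Longrightarrow> X i \<in> vector_fields M) \<Longrightarrow> (\<Sum>i\<in>I. X i) \<in> vector_fields M"
  by (induction I rule: infinite_finite_induct) (auto intro: vector_field_zero vector_field_add)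

end


section \<open>Orthogonal projections onto smooth distributions\<close>

lemma sum_fun_apply: "(\<Sum>i\<in>I. f i) x = (\<Sum>i\<in>I. f i x)"
  by (induction I rule: infinite_finite_induct) auto

text \<open>A basis chosen among the \<open>k\<close> listed vectors already has \<open>k\<close>
  elements, so nothing is listed twice and nothing is redundant. This turns the constant rank of a
  smooth distribution into the independence that Gram-Schmidt asks for.\<close>

lemma independent_of_dim_span_image:
  assumes "dim (span (f ` {..<k})) = k"
  shows "inj_on f {..<k}" "independent (f ` {..<k})"
proof -
  obtain B where B: "B \<subseteq> f ` {..<k}" "independent B" "card B = k"
    using basis_exists[of "f ` {..<k}"] assms by (metis dim_span)
  have c: "card (f ` {..<k}) \<le> k" using card_image_le[of "{..<k}" f] by simp
  have "B = f ` {..<k}" using B(1) B(3) c by (intro card_seteq) auto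
  then show "inj_on f {..<k}" "independent (f ` {..<k})"
    using B by (auto intro: eq_card_imp_inj_on)
qed

locale riemannian_manifold = smooth_manifold M
  for M :: "('m::{t2_space,second_countable_topology}, 'e::euclidean_space) atlas" +
  fixes g :: "'m metric"
  assumes metric: "riemannian_metric M g"
begin

abbreviation TM where "TM \<equiv> tangent_space M"
abbreviation VF where "VF \<equiv> vector_fields M"

lemmas TM_add = subspace_add[OF subspace_tangent_space]
  and TM_diff = subspace_diff[OF subspace_tangent_space]
  and TM_scale = subspace_scale[OF subspace_tangent_space]
  and TM_0 = subspace_0[OF subspace_tangent_space]
  and TM_sum = subspace_sum[OF subspace_tangent_space]
  and TM_neg = subspace_neg[OF subspace_tangent_space]

section \<open>Pointwise linear algebra of the metric\<close>

lemma g_add_left: "u \<in> TM p \<Longrightarrow> v \<in> TM p \<Longrightarrow> w \<in> TM p \<Longrightarrow> g p (u + v) w = g p u w + g p v w"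
  and g_scale_left: "u \<in> TM p \<Longrightarrow> w \<in> TM p \<Longrightarrow> g p (c *\<^sub>R u) w = c * g p u w"
  and g_sym: "u \<in> TM p \<Longrightarrow> w \<in> TM p \<Longrightarrow> g p u w = g p w u"
  and g_pos: "u \<in> TM p \<Longrightarrow> u \<noteq> 0 \<Longrightarrow> g p u u > 0"
  using metric unfolding riemannian_metric_def by metis+

lemma g_smooth: "X \<in> VF \<Longrightarrow> Y \<in> VF \<Longrightarrow> (\<lambda>p. g p (X p) (Y p)) \<in> smooth_fun M"
  using metric unfolding riemannian_metric_def by blast

lemma g_add_right: "u \<in> TM p \<Longrightarrow> v \<in> TM p \<Longrightarrow> w \<in> TM p \<Longrightarrow> g p w (u + v) = g p w u + g p w v"
  by (metis g_add_left g_sym TM_add)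

lemma g_scale_right: "u \<in> TM p \<Longrightarrow> w \<in> TM p \<Longrightarrow> g p w (c *\<^sub>R u) = c * g p w u"
  by (metis g_scale_left g_sym TM_scale)

lemma g_0: "w \<in> TM p \<Longrightarrow> g p 0 w = 0" "w \<in> TM p \<Longrightarrow> g p w 0 = 0"
  using g_scale_left[of 0 p w 0] g_scale_right[of 0 p w 0] TM_0 by auto

lemma g_neg: "u \<in> TM p \<Longrightarrow> w \<in> TM p \<Longrightarrow> g p (- u) w = - g p u w"
    "u \<in> TM p \<Longrightarrow> w \<in> TM p \<Longrightarrow> g p w (- u) = - g p w u"
  using g_scale_left[of u p w "-1"] g_scale_right[of u p w "-1"] by auto

lemma g_diff_left: "u \<in> TM p \<Longrightarrow> v \<in> TM p \<Longrightarrow> w \<in> TM p \<Longrightarrow> g p (u - v) w = g p u w - g p v w"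
  and g_diff_right: "u \<in> TM p \<Longrightarrow> v \<in> TM p \<Longrightarrow> w \<in> TM p \<Longrightarrow> g p w (u - v) = g p w u - g p w v"
  using g_add_left[of u p "-v" w] g_add_right[of u p "-v" w] g_neg[of v p w] TM_neg by auto

lemma g_sum_left:
  "(\<And>i. i \<in> I \<Longrightarrow> u i \<in> TM p) \<Longrightarrow> w \<in> TM p \<Longrightarrow> g p (\<Sum>i\<in>I. u i) w = (\<Sum>i\<in>I. g p (u i) w)"
proof (induction I rule: infinite_finite_induct)
  case (insert i I)
  have "g p (u i + sum u I) w = g p (u i) w + g p (sum u I) w"
    using insert.prems by (intro g_add_left TM_sum) auto
  then show ?case using insert by (metis insertI2 sum.insert)
qed (auto simp: g_0)

lemma g_nonneg: "u \<in> TM p \<Longrightarrow> g p u u \<ge> 0"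
  using g_pos[of u p] g_0[of u p] by (cases "u = 0") auto

lemma g_eq_0_iff: "u \<in> TM p \<Longrightarrow> g p u u = 0 \<longleftrightarrow> u = 0"
  using g_pos[of u p] g_0[of u p] by (cases "u = 0") auto

text \<open>Two candidates differ by a vector of \<open>S\<close> orthogonal to \<open>S\<close>,
  hence to itself, and positivity of \<open>g\<close> makes it zero. The evaluations of
  \<open>orth_proj\<close> below rest on this.\<close>

lemma orth_proj_eqI:
  assumes "subspace S" "S \<subseteq> TM p" "v \<in> TM p" "w \<in> S" "\<And>u. u \<in> S \<Longrightarrow> g p (v - w) u = 0"
  shows "orth_proj g p S v = w"
  unfolding orth_proj_def
proof (rule the_equality)
  fix z assume z: "z \<in> S \<and> (\<forall>u\<in>S. g p (v - z) u = 0)"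
  have d: "z - w \<in> S" using z assms by (auto intro: subspace_diff)
  have T: "z \<in> TM p" "w \<in> TM p" "z - w \<in> TM p" "v - z \<in> TM p" "v - w \<in> TM p"
    using z d assms by (auto intro: TM_diff)
  have "g p (z - w) (z - w) = g p (v - w) (z - w) - g p (v - z) (z - w)"
    using g_diff_left[of "v - w" p "v - z" "z - w"] T by simp
  then have "g p (z - w) (z - w) = 0" using assms(5)[OF d] z d by simp
  then show "z = w" using g_eq_0_iff T by simp
qed (use assms in auto)

lemma g_span_right:
  assumes "S \<subseteq> TM p" "v \<in> TM p" "\<And>u. u \<in> S \<Longrightarrow> g p v u = 0" "u \<in> span S"
  shows "g p v u = 0"
proof -
  have "subspace {u \<in> TM p. g p v u = 0}"
    using assms(2) by (auto simp: subspace_def g_0 g_add_right g_scale_right TM_0 TM_add TM_scale)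
  then have "span S \<subseteq> {u \<in> TM p. g p v u = 0}"
    using assms(1,3) by (intro span_minimal) auto
  then show ?thesis using assms(4) by auto
qed

lemma orthogonal_expansion:
  fixes E :: "nat \<Rightarrow> 'm tvec"
  assumes E: "\<And>i. i < k \<Longrightarrow> E i \<in> TM p" "\<And>i. i < k \<Longrightarrow> E i \<noteq> 0"
    and orth: "\<And>i j. i < k \<Longrightarrow> j < k \<Longrightarrow> i \<noteq> j \<Longrightarrow> g p (E i) (E j) = 0"
    and v: "v \<in> TM p"
  defines "w \<equiv> \<Sum>i<k. (g p v (E i) * inverse (g p (E i) (E i))) *\<^sub>R E i"
  shows "w \<in> span (E ` {..<k})" "u \<in> span (E ` {..<k}) \<Longrightarrow> g p (v - w) u = 0"
proof -
  show "w \<in> span (E ` {..<k})"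
    unfolding w_def by (intro span_sum span_scale span_base) auto
  have w: "w \<in> TM p" unfolding w_def using E by (auto intro!: TM_sum TM_scale)
  have "g p (v - w) (E j) = 0" if j: "j < k" for j
  proof -
    have "g p w (E j) = (\<Sum>i<k. g p v (E i) * inverse (g p (E i) (E i)) * g p (E i) (E j))"
      unfolding w_def using E j by (subst g_sum_left) (auto simp: g_scale_left TM_scale)
    also have "\<dots> = (\<Sum>i<k. if i = j then g p v (E j) else 0)"
      using E j orth g_eq_0_iff[of "E j" p] by (intro sum.cong) auto
    also have "\<dots> = g p v (E j)" using j by simp
    finally show ?thesis using w v E j by (simp add: g_diff_left)
  qed
  then show "g p (v - w) u = 0" if "u \<in> span (E ` {..<k})"
    using g_span_right[OF _ _ _ that, of p "v - w"] E(1) TM_diff[OF v w] by auto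
qed

text \<open>Gram--Schmidt with the denominators multiplied out, so that the orthogonal fields are
  global and smooth even where the given fields degenerate.\<close>

lemma gram_schmidt:
  fixes X :: "nat \<Rightarrow> 'm vfield"
  assumes "\<And>i. i < n \<Longrightarrow> X i \<in> VF"
  shows "\<exists>E. (\<forall>i<n. E i \<in> VF) \<and> (\<forall>i<n. \<forall>j<n. i \<noteq> j \<longrightarrow> (\<forall>q. g q (E i q) (E j q) = 0)) \<and>
    (\<forall>q. inj_on (\<lambda>i. X i q) {..<n} \<longrightarrow> independent ((\<lambda>i. X i q) ` {..<n}) \<longrightarrow>
      span ((\<lambda>i. E i q) ` {..<n}) = span ((\<lambda>i. X i q) ` {..<n}) \<and> (\<forall>i<n. E i q \<noteq> 0))"
  using assms
proof (induction n)
  case 0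
  then show ?case by auto
next
  case (Suc n)
  obtain E where EX: "\<forall>i<n. E i \<in> VF"
    "\<forall>i<n. \<forall>j<n. i \<noteq> j \<longrightarrow> (\<forall>q. g q (E i q) (E j q) = 0)"
    "\<forall>q. inj_on (\<lambda>i. X i q) {..<n} \<longrightarrow> independent ((\<lambda>i. X i q) ` {..<n}) \<longrightarrow>
      span ((\<lambda>i. E i q) ` {..<n}) = span ((\<lambda>i. X i q) ` {..<n}) \<and> (\<forall>i<n. E i q \<noteq> 0)"
    using Suc.IH[OF Suc.prems[OF less_SucI]] by blast
  note E = EX(1)[rule_format] and orth = EX(2)[rule_format] and span = EX(3)[rule_format]
  define N where "N J q = (\<Prod>j\<in>J. g q (E j q) (E j q))" for J q
  \<comment> \<open>The Fourier coefficient of \<open>X n\<close> along \<open>E i\<close>,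
    multiplied by the common denominator \<open>N {..<n}\<close>; leaving \<open>i\<close> out of
    the product cancels its own squared length.\<close>
  define c where "c i q = N ({..<n} - {i}) q * g q (X n q) (E i q)" for i q
  define s where "s = (\<Sum>i<n. (\<lambda>q. c i q *\<^sub>R E i q))"
  define Y where "Y = (\<lambda>q. N {..<n} q *\<^sub>R X n q) - s"
  have Xn: "X n \<in> VF" by (rule Suc.prems) simp
  have N: "N J \<in> smooth_fun M" if "J \<subseteq> {..<n}" for J
    unfolding N_def using that E by (intro smooth_fun_prod g_smooth) auto
  have c: "c i \<in> smooth_fun M" if "i < n" for i
    unfolding c_def using that N E Xn by (intro smooth_fun_mult g_smooth) auto
  have s: "s \<in> VF" unfolding s_def
    by (intro vector_field_sum vector_field_scale) (use c E in auto)
  have Y: "Y \<in> VF" unfolding Y_def using N Xn s by (intro vector_field_diff vector_field_scale) auto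
  have sq: "s q = (\<Sum>i<n. c i q *\<^sub>R E i q)" for q unfolding s_def by (simp add: sum_fun_apply)
  have Yq: "Y q = N {..<n} q *\<^sub>R X n q - s q" for q unfolding Y_def by simp
  have YE: "g q (Y q) (E j q) = 0" if j: "j < n" for j q
  proof -
    note T = vector_field_tangent[OF E] vector_field_tangent[OF Xn] vector_field_tangent[OF s]
    have "g q (s q) (E j q) = (\<Sum>i<n. c i q * g q (E i q) (E j q))"
      unfolding sq using T j by (subst g_sum_left) (auto simp: g_scale_left TM_scale)
    also have "\<dots> = (\<Sum>i<n. if i = j then c j q * g q (E j q) (E j q) else 0)"
      using orth j by (intro sum.cong) auto
    also have "\<dots> = N {..<n} q * g q (X n q) (E j q)"
      using j by (simp add: c_def N_def prod.remove[of "{..<n}" j])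
    finally show ?thesis unfolding Yq using T j by (simp add: g_diff_left g_scale_left TM_scale)
  qed
  define E' where "E' = E(n := Y)"
  have E': "E' i \<in> VF" if "i < Suc n" for i using that E Y by (auto simp: E'_def)
  moreover have "g q (E' i q) (E' j q) = 0" if "i < Suc n" "j < Suc n" "i \<noteq> j" for i j q
    using that YE orth g_sym[OF vector_field_tangent[OF E] vector_field_tangent[OF Y]]
    by (auto simp: E'_def less_Suc_eq)
  moreover have "span ((\<lambda>i. E' i q) ` {..<Suc n}) = span ((\<lambda>i. X i q) ` {..<Suc n}) \<and>
      (\<forall>i<Suc n. E' i q \<noteq> 0)"
    if inj: "inj_on (\<lambda>i. X i q) {..<Suc n}" and ind: "independent ((\<lambda>i. X i q) ` {..<Suc n})" for q
  proof -
    let ?X = "(\<lambda>i. X i q) ` {..<n}" and ?E = "(\<lambda>i. E i q) ` {..<n}"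
    have img: "(\<lambda>i. X i q) ` {..<Suc n} = insert (X n q) ?X"
      "(\<lambda>i. E' i q) ` {..<Suc n} = insert (Y q) ?E"
      by (auto simp: lessThan_Suc E'_def)
    have "X n q \<notin> ?X" by (auto dest: inj_onD[OF inj, of n])
    then have ind': "independent ?X" "X n q \<notin> span ?X"
      using ind unfolding img by (auto simp: independent_insert)
    then have sp: "span ?E = span ?X" and E0: "\<And>i. i < n \<Longrightarrow> E i q \<noteq> 0"
      using span[of q] inj by (auto simp: inj_on_def)
    have "N {..<n} q \<noteq> 0"
      unfolding N_def using E0 g_eq_0_iff vector_field_tangent[OF E] by auto
    moreover have ss: "s q \<in> span ?E" unfolding sq by (intro span_sum span_scale span_base) auto
    \<comment> \<open>Where the earlier fields do not vanish the factor \<open>N {..<n} q\<close>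
      can be inverted, so \<open>X n q\<close> and \<open>Y q\<close> are interchangeable modulo
      \<open>span ?E\<close>.\<close>
    ultimately have Xq: "X n q = inverse (N {..<n} q) *\<^sub>R (Y q + s q)"
      by (simp add: Yq)
    then have "Y q \<notin> span ?E"
      using ind'(2) ss span_add span_scale unfolding sp[symmetric] by metis
    then have "Y q \<noteq> 0" using span_0 by metis
    have "span (insert (Y q) ?E) = span (insert (X n q) ?X)"
    proof -
      have "span (insert (X n q) ?X) = span (insert (X n q) ?E)"
        using sp by (simp add: span_insert)
      also have "\<dots> = span (insert (Y q) ?E)"
      proof (intro subset_antisym span_minimal subspace_span)
        have "s q \<in> span (insert (Y q) ?E)" using ss span_mono[of ?E "insert (Y q) ?E"] by auto
        then have "X n q \<in> span (insert (Y q) ?E)"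
          unfolding Xq by (intro span_add span_scale) (auto intro: span_base)
        then show "insert (X n q) ?E \<subseteq> span (insert (Y q) ?E)"
          by (auto intro: span_base)
        have "s q \<in> span (insert (X n q) ?E)" using ss span_mono[of ?E "insert (X n q) ?E"] by auto
        then have "Y q \<in> span (insert (X n q) ?E)"
          unfolding Yq by (intro span_diff span_scale) (auto intro: span_base)
        then show "insert (Y q) ?E \<subseteq> span (insert (X n q) ?E)"
          by (auto intro: span_base)
      qed
      finally show ?thesis by simp
    qed
    then show ?thesis unfolding img using E0 \<open>Y q \<noteq> 0\<close> by (auto simp: E'_def less_Suc_eq)
  qed
  ultimately show ?case by (intro exI[of _ E']) blast
qed

end

section \<open>Projection onto a distribution of constant rank\<close>

locale tangent_distribution = riemannian_manifold M g
  for M :: "('m::{t2_space,second_countable_topology}, 'e::euclidean_space) atlas" and g +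
  fixes D :: "'m \<Rightarrow> 'm tvec set"
  assumes smooth: "smooth_distribution M D" and tangent: "D p \<subseteq> tangent_space M p"
begin

lemma subspace: "subspace (D p)"
  using smooth unfolding smooth_distribution_def by (metis subspace_span)

text \<open>Constant rank makes the spanning fields independent at every point of \<open>W\<close>,
  so the Gram-Schmidt fields, which are global, do not vanish there and have the same span.\<close>

lemma orthogonal_frame:
  obtains k W E where "open W" "p \<in> W" "\<And>i. i < (k::nat) \<Longrightarrow> E i \<in> VF"
    "\<And>i j q. i < k \<Longrightarrow> j < k \<Longrightarrow> i \<noteq> j \<Longrightarrow> g q (E i q) (E j q) = 0"
    "\<And>i q. i < k \<Longrightarrow> q \<in> W \<Longrightarrow> E i q \<noteq> 0"
    "\<And>q. q \<in> W \<Longrightarrow> D q = span ((\<lambda>i. E i q) ` {..<k})"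
proof -
  obtain k where k: "\<And>p. dim (D p) = k" and
    ex: "\<And>p. \<exists>W X. open W \<and> p \<in> W \<and> (\<forall>i<k. X i \<in> VF) \<and> (\<forall>q\<in>W. D q = span ((\<lambda>i. X i q) ` {..<k}))"
    using smooth unfolding smooth_distribution_def by auto
  obtain W and X :: "nat \<Rightarrow> 'm vfield" where W: "open W" "p \<in> W"
    and X: "\<And>i. i < k \<Longrightarrow> X i \<in> VF"
    and D: "\<And>q. q \<in> W \<Longrightarrow> D q = span ((\<lambda>i. X i q) ` {..<k})"
    using ex[of p] by blast
  obtain E where EX: "\<forall>i<k. E i \<in> VF"
    "\<forall>i<k. \<forall>j<k. i \<noteq> j \<longrightarrow> (\<forall>q. g q (E i q) (E j q) = 0)"
    "\<forall>q. inj_on (\<lambda>i. X i q) {..<k} \<longrightarrow> independent ((\<lambda>i. X i q) ` {..<k}) \<longrightarrow>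
      span ((\<lambda>i. E i q) ` {..<k}) = span ((\<lambda>i. X i q) ` {..<k}) \<and> (\<forall>i<k. E i q \<noteq> 0)"
    using gram_schmidt[of k X, OF X] by blast
  note E = EX[rule_format]
  have "D q = span ((\<lambda>i. E i q) ` {..<k}) \<and> (\<forall>i<k. E i q \<noteq> 0)" if "q \<in> W" for q
    using E(3)[OF independent_of_dim_span_image] k[of q] D[OF that] by simp
  then show thesis by (intro that[OF W E(1,2)]) auto
qed

abbreviation proj where "proj p \<equiv> orth_proj g p (D p)"

lemma proj_expansion:
  assumes "\<And>i. i < (k::nat) \<Longrightarrow> E i \<in> TM p" "\<And>i. i < k \<Longrightarrow> E i \<noteq> 0"
    "\<And>i j. i < k \<Longrightarrow> j < k \<Longrightarrow> i \<noteq> j \<Longrightarrow> g p (E i) (E j) = 0"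
    "D p = span (E ` {..<k})" "v \<in> TM p"
  shows "proj p v = (\<Sum>i<k. (g p v (E i) * inverse (g p (E i) (E i))) *\<^sub>R E i)"
  using orthogonal_expansion[of k E p v] assms tangent
  by (intro orth_proj_eqI[OF subspace tangent assms(5)]) auto

text \<open>The description behind \<open>orth_proj\<close> needs a witness; the finite orthogonal
  frame at \<open>p\<close> supplies it through the explicit expansion.\<close>

lemma proj:
  assumes "v \<in> TM p"
  shows proj_in: "proj p v \<in> D p" and proj_orth: "u \<in> D p \<Longrightarrow> g p (v - proj p v) u = 0"
proof -
  obtain k W E where WE: "open W" "p \<in> W" "\<And>i. i < (k::nat) \<Longrightarrow> E i \<in> VF"
    "\<And>i j q. i < k \<Longrightarrow> j < k \<Longrightarrow> i \<noteq> j \<Longrightarrow> g q (E i q) (E j q) = 0"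
    "\<And>i q. i < k \<Longrightarrow> q \<in> W \<Longrightarrow> E i q \<noteq> 0"
    "\<And>q. q \<in> W \<Longrightarrow> D q = span ((\<lambda>i. E i q) ` {..<k})"
    by (rule orthogonal_frame[of p]) blast
  note a = vector_field_tangent[OF WE(3)] WE(5)[OF _ WE(2)] WE(4)
  show "proj p v \<in> D p" "u \<in> D p \<Longrightarrow> g p (v - proj p v) u = 0"
    using orthogonal_expansion[of k "\<lambda>i. E i p" p v] proj_expansion[of k "\<lambda>i. E i p" p v]
      a WE(6)[OF WE(2)] assms by auto
qed

lemma proj_tangent: "v \<in> TM p \<Longrightarrow> proj p v \<in> TM p"
  using proj_in tangent by blast

lemma proj_eqI: "v \<in> TM p \<Longrightarrow> w \<in> D p \<Longrightarrow> (\<And>u. u \<in> D p \<Longrightarrow> g p (v - w) u = 0) \<Longrightarrow> proj p v = w"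
  using orth_proj_eqI[OF subspace tangent] by blast

lemma proj_inner: "v \<in> TM p \<Longrightarrow> u \<in> D p \<Longrightarrow> g p (proj p v) u = g p v u"
  using proj_orth[of v p u] g_diff_left[of v p "proj p v" u] proj_tangent tangent by force

lemma proj_add:
  assumes "u \<in> TM p" "v \<in> TM p"
  shows "proj p (u + v) = proj p u + proj p v"
proof (rule proj_eqI)
  fix w assume w: "w \<in> D p"
  have "w \<in> TM p" using w tangent by blast
  then show "g p (u + v - (proj p u + proj p v)) w = 0"
    using proj_inner[OF assms(1) w] proj_inner[OF assms(2) w] assms proj_tangent
    by (simp only: g_diff_left g_add_left TM_add)
qed (intro TM_add subspace_add[OF subspace] proj_in assms)+

lemma proj_scale:
  assumes "v \<in> TM p"
  shows "proj p (c *\<^sub>R v) = c *\<^sub>R proj p v"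
proof (rule proj_eqI)
  fix w assume w: "w \<in> D p"
  have "w \<in> TM p" using w tangent by blast
  then show "g p (c *\<^sub>R v - c *\<^sub>R proj p v) w = 0"
    using proj_inner[OF assms w] assms proj_tangent
    by (simp only: g_diff_left g_scale_left TM_scale)
qed (intro TM_scale subspace_scale[OF subspace] proj_in assms)+

text \<open>Near each point the projection is a finite combination of global fields. Its
  coefficients contain reciprocals of squared lengths, which are smooth on \<open>W\<close>, and
  smoothness is a local matter.\<close>

lemma proj_vector_field:
  assumes "X \<in> VF"
  shows "(\<lambda>p. proj p (X p)) \<in> VF"
  unfolding vector_fields_def
proof (intro CollectI conjI allI ballI)
  fix p show "proj p (X p) \<in> TM p" using assms by (intro proj_tangent vector_field_tangent)
next
  fix f assume f: "f \<in> smooth_fun M"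
  show "(\<lambda>p. proj p (X p) f) \<in> smooth_fun M"
    unfolding smooth_fun_on_UNIV[symmetric]
  proof (rule smooth_fun_on_local)
    fix p
    obtain k W E where WE: "open W" "p \<in> W" "\<And>i. i < (k::nat) \<Longrightarrow> E i \<in> VF"
      "\<And>i j q. i < k \<Longrightarrow> j < k \<Longrightarrow> i \<noteq> j \<Longrightarrow> g q (E i q) (E j q) = 0"
      "\<And>i q. i < k \<Longrightarrow> q \<in> W \<Longrightarrow> E i q \<noteq> 0"
      "\<And>q. q \<in> W \<Longrightarrow> D q = span ((\<lambda>i. E i q) ` {..<k})"
      by (rule orthogonal_frame[of p]) blast
    have "(\<lambda>q. \<Sum>i<n. g q (X q) (E i q) * inverse (g q (E i q) (E i q)) * E i q f) \<in> smooth_fun_on M W"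
      if "n \<le> k" for n
      using that
    proof (induction n)
      case (Suc n)
      have n: "n < k" using Suc.prems by simp
      have "g q (E n q) (E n q) \<noteq> 0" if "q \<in> W" for q
        using WE(5)[OF n that] g_eq_0_iff[OF vector_field_tangent[OF WE(3)[OF n]]] by blast
      then have "(\<lambda>q. g q (X q) (E n q) * inverse (g q (E n q) (E n q)) * E n q f) \<in> smooth_fun_on M W"
        by (intro smooth_fun_on_mult smooth_fun_on_inverse WE(1)
            smooth_fun_imp_on[OF g_smooth] smooth_fun_imp_on[OF vector_field_smooth] assms f WE(3) n)
      then show ?case
        using Suc smooth_fun_on_add[OF WE(1)] by simp
    qed (simp add: smooth_fun_on_const)
    from this[of k] have "(\<lambda>q. proj q (X q) f) \<in> smooth_fun_on M W"
    proof (rule smooth_fun_on_cong[OF WE(1)])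
      fix q assume q: "q \<in> W"
      show "(\<Sum>i<k. g q (X q) (E i q) * inverse (g q (E i q) (E i q)) * E i q f) = proj q (X q) f"
        using proj_expansion[of k "\<lambda>i. E i q" q "X q"] WE(5)[OF _ q] WE(4,6) q
          vector_field_tangent[OF WE(3)] vector_field_tangent[OF assms]
        by (simp add: sum_fun_apply scaleR_fun_def)
    qed simp
    then show "\<exists>V. open V \<and> p \<in> V \<and> (\<lambda>p. proj p (X p) f) \<in> smooth_fun_on M V"
      using WE(1,2) by blast
  qed
qed

text \<open>The factor \<open>\<beta>\<close> is a bump function times the squared lengths of an orthogonal frame, which
  keeps the coefficients \<open>b i\<close> free of denominators and hence globally smooth.\<close>

lemma section_vanishing:
  assumes "X \<in> sections M D" "X p = 0"
  obtains \<beta> b E and k :: nat where "\<beta> \<in> smooth_fun M" "\<beta> p \<noteq> 0"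
    "\<And>i. i < k \<Longrightarrow> E i \<in> VF" "\<And>i. i < k \<Longrightarrow> b i \<in> smooth_fun M" "\<And>i. i < k \<Longrightarrow> b i p = 0"
    "(\<lambda>q. \<beta> q *\<^sub>R X q) = (\<lambda>q. \<Sum>i<k. b i q *\<^sub>R E i q)"
proof -
  obtain k W E where WE: "open W" "p \<in> W" "\<And>i. i < (k::nat) \<Longrightarrow> E i \<in> VF"
    "\<And>i j q. i < k \<Longrightarrow> j < k \<Longrightarrow> i \<noteq> j \<Longrightarrow> g q (E i q) (E j q) = 0"
    "\<And>i q. i < k \<Longrightarrow> q \<in> W \<Longrightarrow> E i q \<noteq> 0"
    "\<And>q. q \<in> W \<Longrightarrow> D q = span ((\<lambda>i. E i q) ` {..<k})"
    by (rule orthogonal_frame[of p]) blast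
  obtain \<gamma> where \<gamma>: "\<gamma> \<in> smooth_fun M" "\<gamma> p \<noteq> 0" "\<And>q. q \<notin> W \<Longrightarrow> \<gamma> q = 0"
    using bump_function[OF WE(1,2)] by metis
  have X: "X \<in> VF" "\<And>q. X q \<in> D q" using assms by (auto simp: sections_def)
  define N where "N J q = (\<Prod>j\<in>J. g q (E j q) (E j q))" for J q
  define b where "b i q = \<gamma> q * (N ({..<k} - {i}) q * g q (X q) (E i q))" for i q
  have N: "N J \<in> smooth_fun M" if "J \<subseteq> {..<k}" for J
    unfolding N_def using that WE by (intro smooth_fun_prod g_smooth) auto
  show thesis
  proof (rule that[of "\<lambda>q. \<gamma> q * N {..<k} q" k E b])
    show "(\<lambda>q. \<gamma> q * N {..<k} q) \<in> smooth_fun M" using N \<gamma> by (intro smooth_fun_mult) auto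
    show "\<gamma> p * N {..<k} p \<noteq> 0"
      using \<gamma>(2) WE(2,5) g_eq_0_iff[OF vector_field_tangent[OF WE(3)]] by (auto simp: N_def)
    show "E i \<in> VF" "b i \<in> smooth_fun M" "b i p = 0" if "i < k" for i
      using that WE(3) N \<gamma>(1) X(1) assms(2) g_0[OF vector_field_tangent[OF WE(3)[OF that]]]
      unfolding b_def by (auto intro!: smooth_fun_mult g_smooth)
    show "(\<lambda>q. (\<gamma> q * N {..<k} q) *\<^sub>R X q) = (\<lambda>q. \<Sum>i<k. b i q *\<^sub>R E i q)"
    proof
      fix q
      show "(\<gamma> q * N {..<k} q) *\<^sub>R X q = (\<Sum>i<k. b i q *\<^sub>R E i q)"
      proof (cases "q \<in> W")
        case True
        have "X q = proj q (X q)"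
          by (rule proj_eqI[symmetric])
            (use X(2) vector_field_tangent[OF X(1)] g_0(1)[OF subsetD[OF tangent]] in auto)
        also have "\<dots> = (\<Sum>i<k. (g q (X q) (E i q) * inverse (g q (E i q) (E i q))) *\<^sub>R E i q)"
          using proj_expansion[of k "\<lambda>i. E i q" q "X q"] WE(5)[OF _ True] WE(4) WE(6)[OF True]
            vector_field_tangent[OF WE(3)] vector_field_tangent[OF X(1)] by simp
        finally have Xq: "X q = (\<Sum>i<k. (g q (X q) (E i q) * inverse (g q (E i q) (E i q))) *\<^sub>R E i q)" .
        have "(\<gamma> q * N {..<k} q) *\<^sub>R X q =
            (\<Sum>i<k. (\<gamma> q * N {..<k} q * (g q (X q) (E i q) * inverse (g q (E i q) (E i q)))) *\<^sub>R E i q)"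
          by (rule trans[OF arg_cong[OF Xq, of "scaleR (\<gamma> q * N {..<k} q)"]])
            (simp add: scaleR_sum_right)
        also have "\<dots> = (\<Sum>i<k. b i q *\<^sub>R E i q)"
        proof (rule sum.cong)
          fix i assume i: "i \<in> {..<k}"
          have "g q (E i q) (E i q) \<noteq> 0"
            using i WE(5) True g_eq_0_iff[OF vector_field_tangent[OF WE(3)]] by auto
          then show "(\<gamma> q * N {..<k} q * (g q (X q) (E i q) * inverse (g q (E i q) (E i q)))) *\<^sub>R E i q =
              b i q *\<^sub>R E i q"
            using i by (simp add: b_def N_def prod.remove[of "{..<k}" i])
        qed simp
        finally show ?thesis .
      next
        case False
        then show ?thesis using \<gamma>(3) by (simp add: b_def)
      qed
    qed
  qed
qed

end


section \<open>The Levi-Civita connection\<close>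

locale levi_civita_manifold = riemannian_manifold M g
  for M :: "('m::{t2_space,second_countable_topology}, 'e::euclidean_space) atlas" and g +
  fixes nabla :: "'m vfield \<Rightarrow> 'm vfield \<Rightarrow> 'm vfield"
  assumes levi_civita: "levi_civita M g nabla"
begin

section \<open>Algebraic rules of the connection\<close>

lemma affine:
  "X \<in> VF \<Longrightarrow> Y \<in> VF \<Longrightarrow> Z \<in> VF \<Longrightarrow> f \<in> smooth_fun M \<Longrightarrow>
    nabla X Y \<in> VF \<and>
    nabla (X + Y) Z = nabla X Z + nabla Y Z \<and>
    nabla (\<lambda>p. f p *\<^sub>R X p) Z = (\<lambda>p. f p *\<^sub>R nabla X Z p) \<and>
    nabla X (Y + Z) = nabla X Y + nabla X Z \<and>
    nabla X (\<lambda>p. f p *\<^sub>R Y p) = (\<lambda>p. X p f *\<^sub>R Y p + f p *\<^sub>R nabla X Y p)"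
  using levi_civita unfolding levi_civita_def affine_connection_def by blast

lemma nabla_add_left: "X \<in> VF \<Longrightarrow> Y \<in> VF \<Longrightarrow> Z \<in> VF \<Longrightarrow> nabla (X + Y) Z = nabla X Z + nabla Y Z"
  and nabla_add_right: "X \<in> VF \<Longrightarrow> Y \<in> VF \<Longrightarrow> Z \<in> VF \<Longrightarrow> nabla X (Y + Z) = nabla X Y + nabla X Z"
  using affine[of X Y Z "\<lambda>x. 0"] smooth_fun_const[of 0] by blast+

lemma nabla_scale_left: "X \<in> VF \<Longrightarrow> Z \<in> VF \<Longrightarrow> f \<in> smooth_fun M \<Longrightarrow>
    nabla (\<lambda>p. f p *\<^sub>R X p) Z = (\<lambda>p. f p *\<^sub>R nabla X Z p)"
  using affine[of X X Z f] by blast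

lemma nabla_scale_right: "X \<in> VF \<Longrightarrow> Y \<in> VF \<Longrightarrow> f \<in> smooth_fun M \<Longrightarrow>
    nabla X (\<lambda>p. f p *\<^sub>R Y p) = (\<lambda>p. X p f *\<^sub>R Y p + f p *\<^sub>R nabla X Y p)"
  using affine[of X Y X f] by blast

lemma nabla_VF: "X \<in> VF \<Longrightarrow> Y \<in> VF \<Longrightarrow> nabla X Y \<in> VF"
  using affine[of X Y X "\<lambda>x. 0"] smooth_fun_const[of 0] by blast

lemma nabla_tangent: "X \<in> VF \<Longrightarrow> Y \<in> VF \<Longrightarrow> nabla X Y p \<in> TM p"
  using nabla_VF vector_field_tangent by blast

lemma metric_compatible: "X \<in> VF \<Longrightarrow> Y \<in> VF \<Longrightarrow> Z \<in> VF \<Longrightarrow>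
    X p (\<lambda>q. g q (Y q) (Z q)) = g p (nabla X Y p) (Z p) + g p (Y p) (nabla X Z p)"
  using levi_civita unfolding levi_civita_def by blast

lemma lie_bracket_eq: "X \<in> VF \<Longrightarrow> Y \<in> VF \<Longrightarrow> lie_bracket X Y p = nabla X Y p - nabla Y X p"
proof -
  assume "X \<in> VF" "Y \<in> VF"
  then have "lie_bracket X Y = nabla X Y - nabla Y X"
    using levi_civita unfolding levi_civita_def by simp
  then show ?thesis by (simp only: fun_diff_def)
qed

text \<open>The inner product of \<open>Y\<close> and \<open>Z\<close> is identically zero, so
  metric compatibility loses its left side. This moves a derivative from one field to the other,
  after which \<open>Y\<close> enters by its value at \<open>p\<close> only.\<close>

lemma nabla_orthogonal:
  assumes "X \<in> VF" "Y \<in> VF" "Z \<in> VF" "\<And>q. g q (Y q) (Z q) = 0"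
  shows "g p (nabla X Y p) (Z p) = - g p (Y p) (nabla X Z p)"
  using metric_compatible[OF assms(1-3), of p] tangent_zero_fun[OF vector_field_tangent[OF assms(1)]]
    assms(4) by simp

section \<open>Locality and tensoriality of the connection\<close>

lemma nabla_zero_left: "Z \<in> VF \<Longrightarrow> nabla (\<lambda>p. 0) Z p = 0"
  using nabla_scale_left[OF vector_field_zero _ smooth_fun_const[of 0], of Z]
  by (simp only: scaleR_zero_left)

lemma nabla_zero_right:
  assumes "X \<in> VF"
  shows "nabla X (\<lambda>p. 0) p = 0"
proof -
  have "nabla X (\<lambda>p. 0 *\<^sub>R 0 p) p = X p (\<lambda>q. 0) *\<^sub>R 0 p + 0 *\<^sub>R nabla X 0 p"
    using nabla_scale_right[OF assms vector_field_zero smooth_fun_const[of 0]] by (rule fun_cong)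
  then show ?thesis
    by (simp only: tangent_zero_fun[OF vector_field_tangent[OF assms]] scaleR_zero_left add_0)
qed

text \<open>For a bump function \<open>\<beta>\<close> vanishing off \<open>W\<close> the field
  \<open>\<beta> (X - X')\<close> is zero everywhere, so \<open>\<beta> p\<close> times the
  derivative along \<open>X - X'\<close> is zero.\<close>

lemma nabla_local_left:
  assumes X: "X \<in> VF" and X': "X' \<in> VF" and Y: "Y \<in> VF"
    and W: "open W" "p \<in> W" "\<And>q. q \<in> W \<Longrightarrow> X q = X' q"
  shows "nabla X Y p = nabla X' Y p"
proof -
  obtain \<beta> where \<beta>: "\<beta> \<in> smooth_fun M" "\<beta> p \<noteq> 0" "\<And>q. q \<notin> W \<Longrightarrow> \<beta> q = 0"
    using bump_function W(1,2) by metis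
  have d: "X - X' \<in> VF" using X X' by (rule vector_field_diff)
  have "\<beta> q *\<^sub>R (X - X') q = 0" for q
    using \<beta>(3)[of q] W(3)[of q] by (cases "q \<in> W") (auto simp: fun_diff_def)
  then have "\<beta> p *\<^sub>R nabla (X - X') Y p = 0"
    using fun_cong[OF nabla_scale_left[OF d Y \<beta>(1)], of p] nabla_zero_left[OF Y] by (simp only:)
  then have "nabla (X - X') Y p = 0" using \<beta>(2) by (simp only: scaleR_eq_0_iff simp_thms)
  then show ?thesis
    using fun_cong[OF nabla_add_left[OF d X' Y], of p]
    by (simp only: diff_add_cancel plus_fun_apply[of "nabla _ _"] add_0)
qed

text \<open>The bump function argument for the second slot: the Leibniz rule leaves a term with the
  derivative of \<open>\<beta>\<close>, which carries the factor
  \<open>(Y - Y') p = 0\<close>.\<close>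

lemma nabla_local_right:
  assumes X: "X \<in> VF" and Y: "Y \<in> VF" and Y': "Y' \<in> VF"
    and W: "open W" "p \<in> W" "\<And>q. q \<in> W \<Longrightarrow> Y q = Y' q"
  shows "nabla X Y p = nabla X Y' p"
proof -
  obtain \<beta> where \<beta>: "\<beta> \<in> smooth_fun M" "\<beta> p \<noteq> 0" "\<And>q. q \<notin> W \<Longrightarrow> \<beta> q = 0"
    using bump_function W(1,2) by metis
  have d: "Y - Y' \<in> VF" using Y Y' by (rule vector_field_diff)
  have Z: "(Y - Y') p = 0" using W(3)[OF W(2)] by (simp only: fun_diff_def[of Y] diff_self)
  have "\<beta> q *\<^sub>R (Y - Y') q = 0" for q
    using \<beta>(3)[of q] W(3)[of q] by (cases "q \<in> W") (auto simp: fun_diff_def)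
  then have "X p \<beta> *\<^sub>R (Y - Y') p + \<beta> p *\<^sub>R nabla X (Y - Y') p = 0"
    using fun_cong[OF nabla_scale_right[OF X d \<beta>(1)], of p] nabla_zero_right[OF X] by (simp only:)
  then have "nabla X (Y - Y') p = 0" using \<beta>(2) by (simp only: Z scaleR_zero_right add_0 scaleR_eq_0_iff simp_thms)
  then show ?thesis
    using fun_cong[OF nabla_add_right[OF X d Y'], of p]
    by (simp only: diff_add_cancel plus_fun_apply[of "nabla _ _"] add_0)
qed

text \<open>Up to the factor \<open>\<beta>\<close>, \<open>X\<close> is a combination of global
  fields with coefficients vanishing at \<open>p\<close>; these pass through the fibrewise linear
  \<open>h\<close> and the function-linear first slot of \<open>nabla\<close>. The map
  \<open>h\<close> is there for the sake of \<open>F\<close>: the fields \<open>F X\<close> are not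
  known to span a smooth distribution, so the expansion is made for \<open>X\<close>, before
  \<open>F\<close> is applied.\<close>

lemma nabla_tensorial_left:
  assumes D: "tangent_distribution M g D" and X: "X \<in> sections M D" "X p = 0" and Y: "Y \<in> VF"
    and H: "\<And>Z. Z \<in> VF \<Longrightarrow> (\<lambda>q. h q (Z q)) \<in> VF"
    and h_add: "\<And>q u v. u \<in> TM q \<Longrightarrow> v \<in> TM q \<Longrightarrow> h q (u + v) = h q u + h q v"
    and h_scale: "\<And>q c u. u \<in> TM q \<Longrightarrow> h q (c *\<^sub>R u) = c *\<^sub>R h q u"
  shows "nabla (\<lambda>q. h q (X q)) Y p = 0"
proof -
  obtain \<beta> b E and k :: nat where \<beta>: "\<beta> \<in> smooth_fun M" "\<beta> p \<noteq> 0"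
    and E: "\<And>i. i < k \<Longrightarrow> E i \<in> VF" and b: "\<And>i. i < k \<Longrightarrow> b i \<in> smooth_fun M" "\<And>i. i < k \<Longrightarrow> b i p = 0"
    and eq: "(\<lambda>q. \<beta> q *\<^sub>R X q) = (\<lambda>q. \<Sum>i<k. b i q *\<^sub>R E i q)"
    by (rule tangent_distribution.section_vanishing[OF D X]) blast
  have XV: "X \<in> VF" using X(1) by (simp add: sections_def)
  have "nabla (\<lambda>q. h q (\<Sum>i<n. b i q *\<^sub>R E i q)) Y p = 0" if "n \<le> k" for n
    using that
  proof (induction n)
    case 0
    have "h q 0 = 0" for q using h_scale[OF TM_0, of q 0] by (simp only: scaleR_zero_left)
    then show ?case using nabla_zero_left[OF Y] by (simp only: lessThan_0 sum.empty)
  next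
    case (Suc n)
    have n: "n < k" using Suc.prems by simp
    let ?S = "\<lambda>q. \<Sum>i<n. b i q *\<^sub>R E i q"
    have "?S = (\<Sum>i<n. (\<lambda>q. b i q *\<^sub>R E i q))" by (rule ext) (simp only: sum_fun_apply)
    then have S: "?S \<in> VF"
      using E b(1) n by (simp only:) (intro vector_field_sum vector_field_scale; simp)
    have "h q (\<Sum>i<Suc n. b i q *\<^sub>R E i q) = h q (?S q) + b n q *\<^sub>R h q (E n q)" for q
      unfolding sum.lessThan_Suc
      using h_add[OF vector_field_tangent[OF S] TM_scale[OF vector_field_tangent[OF E[OF n]]]]
        h_scale[OF vector_field_tangent[OF E[OF n]]] by (simp only:)
    then have "(\<lambda>q. h q (\<Sum>i<Suc n. b i q *\<^sub>R E i q)) =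
        (\<lambda>q. h q (?S q)) + (\<lambda>q. b n q *\<^sub>R h q (E n q))"
      by (intro ext) (simp only: plus_fun_apply)
    then have "nabla (\<lambda>q. h q (\<Sum>i<Suc n. b i q *\<^sub>R E i q)) Y p =
        nabla (\<lambda>q. h q (?S q)) Y p + b n p *\<^sub>R nabla (\<lambda>q. h q (E n q)) Y p"
      using nabla_add_left[OF H[OF S] vector_field_scale[OF H[OF E[OF n]] b(1)[OF n]] Y]
        nabla_scale_left[OF H[OF E[OF n]] Y b(1)[OF n]] by (simp only: plus_fun_apply)
    then show ?case using Suc.IH b(2)[OF n] n by (simp only: scaleR_zero_left) simp
  qed
  from this[of k] have "nabla (\<lambda>q. h q (\<beta> q *\<^sub>R X q)) Y p = 0"
    using eq by (metis order_refl)
  moreover have "(\<lambda>q. h q (\<beta> q *\<^sub>R X q)) = (\<lambda>q. \<beta> q *\<^sub>R h q (X q))"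
    using h_scale vector_field_tangent[OF XV] by blast
  ultimately have "\<beta> p *\<^sub>R nabla (\<lambda>q. h q (X q)) Y p = 0"
    using nabla_scale_left[OF H[OF XV] Y \<beta>(1)] by metis
  then show ?thesis using \<beta>(2) by (simp only: scaleR_eq_0_iff simp_thms)
qed

end


section \<open>Bi-slant submersions\<close>

locale bi_slant = levi_civita_manifold M g nabla
  for M :: "('m::{t2_space,second_countable_topology}, 'e::euclidean_space) atlas" and g nabla +
  fixes N :: "('n::{t2_space,second_countable_topology}, 'd::euclidean_space) atlas"
    and g\<^sub>N :: "'n metric" and J :: "'m \<Rightarrow> 'm tvec \<Rightarrow> 'm tvec" and \<pi> :: "'m \<Rightarrow> 'n"
    and D\<^sub>1 D\<^sub>2 :: "'m \<Rightarrow> 'm tvec set" and \<theta>\<^sub>1 \<theta>\<^sub>2 :: real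
  assumes kaehler: "kaehler M g J nabla" and metric_N: "riemannian_metric N g\<^sub>N"
    and bi_slant: "bi_slant_submersion M g J N g\<^sub>N \<pi> D\<^sub>1 \<theta>\<^sub>1 D\<^sub>2 \<theta>\<^sub>2"
    and J_orthogonal: "u \<in> D\<^sub>1 p \<Longrightarrow> w \<in> D\<^sub>2 p \<Longrightarrow> g p (J p u) w = 0"
begin

abbreviation Vert where "Vert \<equiv> vertical_space M N \<pi>"
abbreviation Horiz where "Horiz \<equiv> horizontal_space M g N \<pi>"
abbreviation P where "P \<equiv> P_part M g J N \<pi>"
abbreviation F where "F \<equiv> F_part M g J N \<pi>"
abbreviation vproj where "vproj p \<equiv> orth_proj g p (Vert p)"
abbreviation hproj where "hproj p \<equiv> orth_proj g p (Horiz p)"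

section \<open>The Kaehler structure\<close>

lemma J_tangent: "u \<in> TM p \<Longrightarrow> J p u \<in> TM p"
  and J_add: "u \<in> TM p \<Longrightarrow> v \<in> TM p \<Longrightarrow> J p (u + v) = J p u + J p v"
  and J_scale: "u \<in> TM p \<Longrightarrow> J p (c *\<^sub>R u) = c *\<^sub>R J p u"
  and J_J: "u \<in> TM p \<Longrightarrow> J p (J p u) = - u"
  and J_isometry: "u \<in> TM p \<Longrightarrow> v \<in> TM p \<Longrightarrow> g p (J p u) (J p v) = g p u v"
  and J_VF: "X \<in> VF \<Longrightarrow> (\<lambda>p. J p (X p)) \<in> VF"
  and nabla_J: "X \<in> VF \<Longrightarrow> Y \<in> VF \<Longrightarrow> nabla X (\<lambda>p. J p (Y p)) = (\<lambda>p. J p (nabla X Y p))"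
  using kaehler unfolding kaehler_def almost_complex_def by blast+

lemma J_skew: "u \<in> TM p \<Longrightarrow> v \<in> TM p \<Longrightarrow> g p (J p u) v = - g p u (J p v)"
  by (metis J_J J_isometry J_tangent g_neg(1))

section \<open>Vertical and horizontal projections\<close>

lemma Vert_decomposition: "Vert p = {u + w |u w. u \<in> D\<^sub>1 p \<and> w \<in> D\<^sub>2 p}"
  and D_orthogonal: "u \<in> D\<^sub>1 p \<Longrightarrow> w \<in> D\<^sub>2 p \<Longrightarrow> g p u w = 0"
  and smooth_D\<^sub>1: "smooth_distribution M D\<^sub>1" and smooth_D\<^sub>2: "smooth_distribution M D\<^sub>2"
  and submersion: "riemannian_submersion M g N g\<^sub>N \<pi>"
  using bi_slant unfolding bi_slant_submersion_def slant_distribution_def by simp_all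

lemma zero_in_D: "0 \<in> D\<^sub>1 p" "0 \<in> D\<^sub>2 p"
  using smooth_D\<^sub>1 smooth_D\<^sub>2 unfolding smooth_distribution_def by (metis span_0)+

lemma D_vertical: "D\<^sub>1 p \<subseteq> Vert p" "D\<^sub>2 p \<subseteq> Vert p"
proof -
  show "D\<^sub>1 p \<subseteq> Vert p"
    unfolding Vert_decomposition using zero_in_D(2) by (force intro: add_0_right[symmetric])
  show "D\<^sub>2 p \<subseteq> Vert p"
    unfolding Vert_decomposition using zero_in_D(1) by (force intro: add_0_left[symmetric])
qed

lemma Vert_tangent: "u \<in> Vert p \<Longrightarrow> u \<in> TM p"
  and Horiz_tangent: "u \<in> Horiz p \<Longrightarrow> u \<in> TM p"
  and Horiz_Vert: "u \<in> Horiz p \<Longrightarrow> v \<in> Vert p \<Longrightarrow> g p u v = 0"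
  by (auto simp: vertical_space_def horizontal_space_def)

lemma Vert_Horiz: "u \<in> Vert p \<Longrightarrow> v \<in> Horiz p \<Longrightarrow> g p u v = 0"
  using Horiz_Vert Vert_tangent Horiz_tangent g_sym by metis

sublocale d\<^sub>1: tangent_distribution M g D\<^sub>1
  using smooth_D\<^sub>1 D_vertical Vert_tangent by unfold_locales blast+

sublocale d\<^sub>2: tangent_distribution M g D\<^sub>2
  using smooth_D\<^sub>2 D_vertical Vert_tangent by unfold_locales blast+

lemma subspace_Vert: "subspace (Vert p)"
  unfolding Vert_decomposition by (rule subspace_sums[OF d\<^sub>1.subspace d\<^sub>2.subspace])

lemma subspace_Horiz: "subspace (Horiz p)"
  unfolding subspace_def horizontal_space_def
  by (auto simp only: mem_Collect_eq g_0 g_add_left g_scale_left Vert_tangent TM_0 TM_add TM_scale)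

text \<open>Orthogonality of \<open>D\<^sub>1\<close> and \<open>D\<^sub>2\<close> makes the two
  projections add up. Existence, linearity and smoothness of the vertical projection are thereby
  inherited from the two smooth distributions.\<close>

lemma vproj_eq:
  assumes v: "v \<in> TM p"
  shows "vproj p v = d\<^sub>1.proj p v + d\<^sub>2.proj p v"
proof (rule orth_proj_eqI[OF subspace_Vert _ v])
  note T = v d\<^sub>1.proj_tangent[OF v] d\<^sub>2.proj_tangent[OF v]
  show "Vert p \<subseteq> TM p" using Vert_tangent by blast
  show "d\<^sub>1.proj p v + d\<^sub>2.proj p v \<in> Vert p"
    unfolding Vert_decomposition using d\<^sub>1.proj_in[OF v] d\<^sub>2.proj_in[OF v] by blast
  fix u assume "u \<in> Vert p"
  then obtain a b where ab: "u = a + b" "a \<in> D\<^sub>1 p" "b \<in> D\<^sub>2 p" unfolding Vert_decomposition by blast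
  then have T': "a \<in> TM p" "b \<in> TM p" using D_vertical Vert_tangent by blast+
  have "g p (v - d\<^sub>1.proj p v) a = 0" "g p (d\<^sub>2.proj p v) a = 0"
    "g p (v - d\<^sub>2.proj p v) b = 0" "g p (d\<^sub>1.proj p v) b = 0"
    using d\<^sub>1.proj_orth[OF v ab(2)] d\<^sub>2.proj_orth[OF v ab(3)]
      D_orthogonal[OF ab(2) d\<^sub>2.proj_in[OF v]] D_orthogonal[OF d\<^sub>1.proj_in[OF v] ab(3)] g_sym T T'
    by metis+
  then show "g p (v - (d\<^sub>1.proj p v + d\<^sub>2.proj p v)) u = 0"
    using T T' unfolding ab(1)
    by (simp only: g_diff_left g_add_right g_add_left TM_diff TM_add)
qed

lemma vproj_in: "v \<in> TM p \<Longrightarrow> vproj p v \<in> Vert p"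
  using vproj_eq d\<^sub>1.proj_in d\<^sub>2.proj_in unfolding Vert_decomposition by blast

lemma vproj_inner:
  assumes "v \<in> TM p" "u \<in> Vert p"
  shows "g p (vproj p v) u = g p v u"
proof -
  obtain a b where ab: "u = a + b" "a \<in> D\<^sub>1 p" "b \<in> D\<^sub>2 p"
    using assms(2) unfolding Vert_decomposition by blast
  then have T: "a \<in> TM p" "b \<in> TM p" using D_vertical Vert_tangent by blast+
  have "g p (d\<^sub>1.proj p v) a = g p v a" "g p (d\<^sub>2.proj p v) a = 0"
    "g p (d\<^sub>2.proj p v) b = g p v b" "g p (d\<^sub>1.proj p v) b = 0"
    using d\<^sub>1.proj_inner[OF assms(1) ab(2)] d\<^sub>2.proj_inner[OF assms(1) ab(3)]
      D_orthogonal[OF ab(2) d\<^sub>2.proj_in[OF assms(1)]] D_orthogonal[OF d\<^sub>1.proj_in[OF assms(1)] ab(3)]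
      g_sym d\<^sub>2.proj_tangent[OF assms(1)] T
    by metis+
  then show ?thesis
    using T assms(1) d\<^sub>1.proj_tangent[OF assms(1)] d\<^sub>2.proj_tangent[OF assms(1)]
    unfolding ab(1) vproj_eq[OF assms(1)]
    by (simp only: g_add_right g_add_left TM_add)
qed

lemma hproj_in: "v \<in> TM p \<Longrightarrow> v - vproj p v \<in> Horiz p"
  using vproj_in vproj_inner Vert_tangent TM_diff
  by (auto simp: horizontal_space_def g_diff_left simp del: minus_apply)

text \<open>The complement of the vertical part is horizontal and differs from \<open>v\<close> by a
  vertical vector, so the horizontal projection is obtained without a frame of its own.\<close>

lemma hproj_eq: "v \<in> TM p \<Longrightarrow> hproj p v = v - vproj p v"
  using vproj_in Vert_Horiz
  by (intro orth_proj_eqI[OF subspace_Horiz] hproj_in) (auto intro: Horiz_tangent)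

lemma vproj_vertical: "v \<in> Vert p \<Longrightarrow> vproj p v = v"
  by (intro orth_proj_eqI[OF subspace_Vert])
    (auto intro: Vert_tangent simp only: diff_self g_0 Vert_tangent)

lemma hproj_horizontal: "v \<in> Horiz p \<Longrightarrow> hproj p v = v"
  by (intro orth_proj_eqI[OF subspace_Horiz])
    (auto intro: Horiz_tangent simp only: diff_self g_0 Horiz_tangent)

lemma ver_VF: "X \<in> VF \<Longrightarrow> ver M g N \<pi> X \<in> VF"
proof -
  assume X: "X \<in> VF"
  have "ver M g N \<pi> X = (\<lambda>p. d\<^sub>1.proj p (X p)) + (\<lambda>p. d\<^sub>2.proj p (X p))"
    unfolding ver_def using vproj_eq vector_field_tangent[OF X] by (auto simp only: plus_fun_apply)
  then show ?thesis
    using vector_field_add d\<^sub>1.proj_vector_field[OF X] d\<^sub>2.proj_vector_field[OF X] by metis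
qed

lemma hor_eq: "X \<in> VF \<Longrightarrow> hor M g N \<pi> X = X - ver M g N \<pi> X"
  unfolding ver_def hor_def fun_diff_def[of X] using hproj_eq vector_field_tangent by blast

lemma hor_VF: "X \<in> VF \<Longrightarrow> hor M g N \<pi> X \<in> VF"
  using hor_eq ver_VF vector_field_diff by metis

section \<open>Brackets, and the symmetries behind O'Neill's tensors\<close>

lemma vertical_iff:
  "v \<in> Vert p \<longleftrightarrow> v \<in> TM p \<and> (\<forall>h\<in>smooth_fun N. v (h \<circ> \<pi>) = 0)"
  by (auto simp: vertical_space_def pushforward_def zero_fun_def fun_eq_iff)

lemma vertical_derivative: "v \<in> Vert p \<Longrightarrow> h \<in> smooth_fun N \<Longrightarrow> v (h \<circ> \<pi>) = 0"
  by (simp add: vertical_iff)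

text \<open>Here \<open>[Y, X] (h \<circ> \<pi>) = Y (h' \<circ> \<pi>) - X 0 = 0\<close>, and
  vanishing torsion turns the bracket into a difference of derivatives. The assumption on
  \<open>X\<close> is made to fit both vertical fields (\<open>h' = 0\<close>) and basic
  ones.\<close>

lemma bracket_vertical:
  assumes X: "X \<in> VF" and Y: "Y \<in> sections M Vert"
    and XY: "\<And>h. h \<in> smooth_fun N \<Longrightarrow> \<exists>h'\<in>smooth_fun N. (\<lambda>q. X q (h \<circ> \<pi>)) = h' \<circ> \<pi>"
  shows "nabla Y X p - nabla X Y p \<in> Vert p"
proof -
  have Y': "Y \<in> VF" "\<And>q. Y q \<in> Vert q" using Y by (auto simp: sections_def)
  have "lie_bracket Y X p (h \<circ> \<pi>) = 0" if h: "h \<in> smooth_fun N" for h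
  proof -
    obtain h' where h': "h' \<in> smooth_fun N" "(\<lambda>q. X q (h \<circ> \<pi>)) = h' \<circ> \<pi>" using XY[OF h] by blast
    have "(\<lambda>q. Y q (h \<circ> \<pi>)) = (\<lambda>q. 0)" using vertical_derivative[OF Y'(2) h] by blast
    then show ?thesis
      unfolding lie_bracket_def h'(2) using vertical_derivative[OF Y'(2) h'(1)]
        tangent_zero_fun[OF vector_field_tangent[OF X]] by simp
  qed
  then show ?thesis
    unfolding vertical_iff lie_bracket_eq[OF Y'(1) X]
    using TM_diff nabla_tangent X Y'(1) by blast
qed

lemma bracket_vertical_vertical:
  assumes "X \<in> sections M Vert" "Y \<in> sections M Vert"
  shows "nabla Y X p - nabla X Y p \<in> Vert p"
proof (rule bracket_vertical[OF _ assms(2)])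
  fix h assume h: "h \<in> smooth_fun N"
  have "(\<lambda>q. X q (h \<circ> \<pi>)) = (\<lambda>q. 0) \<circ> \<pi>"
    using assms(1) vertical_derivative[OF _ h] by (auto simp: sections_def)
  moreover have "(\<lambda>q. 0) \<in> smooth_fun N"
    by (auto simp: smooth_fun_def comp_def smooth_on_const)
  ultimately show "\<exists>h'\<in>smooth_fun N. (\<lambda>q. X q (h \<circ> \<pi>)) = h' \<circ> \<pi>" by blast
qed (use assms in \<open>simp add: sections_def\<close>)

lemma bracket_basic_vertical:
  assumes "basic M g N \<pi> X" "Y \<in> sections M Vert"
  shows "nabla Y X p - nabla X Y p \<in> Vert p"
proof (rule bracket_vertical[OF _ assms(2)])
  obtain Z where Z: "Z \<in> vector_fields N" "\<And>q. pushforward N \<pi> (X q) = Z (\<pi> q)"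
    using assms(1) by (auto simp: basic_def)
  fix h assume h: "h \<in> smooth_fun N"
  have "X q (h \<circ> \<pi>) = Z (\<pi> q) h" for q
    using fun_cong[OF Z(2), of q h] h by (simp add: pushforward_def)
  then have "(\<lambda>q. X q (h \<circ> \<pi>)) = (\<lambda>q. Z q h) \<circ> \<pi>" by auto
  moreover have "(\<lambda>q. Z q h) \<in> smooth_fun N" using Z(1) h by (simp add: vector_fields_def)
  ultimately show "\<exists>h'\<in>smooth_fun N. (\<lambda>q. X q (h \<circ> \<pi>)) = h' \<circ> \<pi>" by blast
qed (use assms in \<open>simp add: basic_def sections_def\<close>)

text \<open>Moving the derivative off \<open>Y\<close> gives
  \<open>- g (Y, \<nabla>\<^sub>B C)\<close>, which is symmetric in \<open>B\<close> and
  \<open>C\<close> since their bracket is vertical: this is the symmetry of the second fundamental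
  form of the fibres.\<close>

lemma nabla_vertical_horizontal_symmetric:
  assumes B: "B \<in> sections M Vert" and C: "C \<in> sections M Vert" and Y: "Y \<in> sections M Horiz"
  shows "g p (nabla B Y p) (C p) = g p (nabla C Y p) (B p)"
proof -
  have VF: "B \<in> VF" "C \<in> VF" "Y \<in> VF" and in_space: "\<And>q. B q \<in> Vert q" "\<And>q. C q \<in> Vert q" "\<And>q. Y q \<in> Horiz q"
    using assms by (auto simp: sections_def)
  have "g p (Y p) (nabla B C p - nabla C B p) = 0"
    by (rule Horiz_Vert[OF in_space(3) bracket_vertical_vertical[OF C B]])
  then have "g p (Y p) (nabla B C p) = g p (Y p) (nabla C B p)"
    using g_diff_right nabla_tangent VF vector_field_tangent by (metis right_minus_eq)
  then show ?thesis
    using nabla_orthogonal[OF VF(1,3,2) Horiz_Vert[OF in_space(3,2)], of p]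
      nabla_orthogonal[OF VF(2,3,1) Horiz_Vert[OF in_space(3,1)], of p] by simp
qed

text \<open>By the isometry on horizontal vectors the inner product is pulled back from the base,
  and vertical vectors annihilate such functions.\<close>

lemma basic_inner_constant:
  assumes X: "basic M g N \<pi> X" and Y: "basic M g N \<pi> Y" and v: "v \<in> Vert p"
  shows "v (\<lambda>q. g q (X q) (Y q)) = 0"
proof -
  obtain Z Z' where Z: "Z \<in> vector_fields N" "\<And>q. pushforward N \<pi> (X q) = Z (\<pi> q)"
    "Z' \<in> vector_fields N" "\<And>q. pushforward N \<pi> (Y q) = Z' (\<pi> q)"
    using X Y by (auto simp: basic_def)
  have h: "X q \<in> Horiz q" "Y q \<in> Horiz q" for q
    using X Y by (auto simp: basic_def sections_def)
  have "g\<^sub>N (\<pi> q) (pushforward N \<pi> (X q)) (pushforward N \<pi> (Y q)) = g q (X q) (Y q)" for q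
    using submersion h[of q] unfolding riemannian_submersion_def by blast
  then have "(\<lambda>q. g q (X q) (Y q)) = (\<lambda>r. g\<^sub>N r (Z r) (Z' r)) \<circ> \<pi>"
    unfolding Z by auto
  moreover have "(\<lambda>r. g\<^sub>N r (Z r) (Z' r)) \<in> smooth_fun N"
    using metric_N Z(1,3) unfolding riemannian_metric_def by blast
  ultimately show ?thesis using vertical_derivative[OF v] by metis
qed

text \<open>A form of the skew-symmetry of O'Neill's tensor \<open>A\<close> on horizontal arguments.\<close>

lemma nabla_basic_symmetric:
  assumes X: "basic M g N \<pi> X" and Y: "basic M g N \<pi> Y" and U: "U \<in> sections M Vert"
  shows "g p (nabla U Y p) (X p) = g p (nabla X Y p) (U p)"
proof -
  have VF: "X \<in> VF" "Y \<in> VF" "U \<in> VF"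
    and in_space: "\<And>q. X q \<in> Horiz q" "\<And>q. Y q \<in> Horiz q" "\<And>q. U q \<in> Vert q"
    using assms by (auto simp: basic_def sections_def)
  note T = vector_field_tangent[OF VF(1)] vector_field_tangent[OF VF(2)] nabla_tangent[OF VF(3,1)]
    nabla_tangent[OF VF(1,3)] nabla_tangent[OF VF(3,2)] vector_field_tangent[OF VF(3)] nabla_tangent[OF VF(1,2)]
  have "g p (nabla U X p - nabla X U p) (Y p) = 0"
    by (rule Vert_Horiz[OF bracket_basic_vertical[OF X U] in_space(2)])
  then have "g p (nabla U X p) (Y p) = g p (nabla X U p) (Y p)"
    using T by (simp only: g_diff_left)
  also have "\<dots> = - g p (nabla X Y p) (U p)"
    using nabla_orthogonal[OF VF(1,3,2) Vert_Horiz[OF in_space(3,2)], of p] g_sym T by metis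
  finally have "g p (nabla U X p) (Y p) = - g p (nabla X Y p) (U p)" .
  \<comment> \<open>Constancy of \<open>g (X, Y)\<close> along the fibres exchanges the roles of
    \<open>X\<close> and \<open>Y\<close>; it uses that both fields are basic.\<close>
  moreover have "g p (nabla U X p) (Y p) + g p (X p) (nabla U Y p) = 0"
    using metric_compatible[OF VF(3,1,2), of p] basic_inner_constant[OF X Y in_space(3)] by simp
  ultimately show ?thesis using g_sym[OF T(1,5), of p] by linarith
qed

section \<open>The operators \<open>P\<close> and \<open>F\<close>\<close>

lemma P_apply: "P X p = vproj p (J p (X p))"
  by (simp only: P_part_def ver_def)

lemma F_apply: "X \<in> VF \<Longrightarrow> F X p = J p (X p) - P X p"
  using hproj_eq J_tangent vector_field_tangent unfolding F_part_def hor_def P_apply by blast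

lemma P_VF: "X \<in> VF \<Longrightarrow> P X \<in> VF"
  and F_VF: "X \<in> VF \<Longrightarrow> F X \<in> VF"
  unfolding P_part_def F_part_def by (auto intro: ver_VF hor_VF J_VF)

lemma J_decomposition: "X \<in> VF \<Longrightarrow> (\<lambda>p. J p (X p)) = P X + F X"
  by (rule ext) (simp only: F_apply plus_fun_apply[of "P X"] add_diff_eq add_diff_cancel_left')

lemma F_horizontal: "X \<in> VF \<Longrightarrow> F X \<in> sections M Horiz"
  using F_VF hproj_in J_tangent vector_field_tangent
  by (simp only: sections_def mem_Collect_eq F_apply P_apply simp_thms)

lemma sections_vertical: "sections M D\<^sub>1 \<subseteq> sections M Vert" "sections M D\<^sub>2 \<subseteq> sections M Vert"
  using D_vertical unfolding sections_def by blast+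

lemma sections_VF: "X \<in> sections M D \<Longrightarrow> X \<in> VF"
  and sections_in: "X \<in> sections M D \<Longrightarrow> X p \<in> D p"
  by (simp_all add: sections_def)

text \<open>The orthogonality assumption on \<open>J\<close> removes the \<open>D\<^sub>2\<close>
  component. So \<open>P\<close> on \<open>D\<^sub>1\<close>, and by skew-symmetry of
  \<open>J\<close> likewise on \<open>D\<^sub>2\<close>, is the projection onto the distribution
  itself, which is what a slant angle measures.\<close>

lemma vproj_J_D\<^sub>1:
  assumes "u \<in> D\<^sub>1 p"
  shows "vproj p (J p u) = d\<^sub>1.proj p (J p u)"
proof -
  have T: "J p u \<in> TM p" using assms d\<^sub>1.tangent J_tangent by blast
  have "d\<^sub>2.proj p (J p u) = 0"
    by (rule d\<^sub>2.proj_eqI[OF T zero_in_D(2)]) (simp only: diff_zero J_orthogonal[OF assms])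
  then show ?thesis by (simp only: vproj_eq[OF T] add_0_right)
qed

lemma vproj_J_D\<^sub>2:
  assumes "w \<in> D\<^sub>2 p"
  shows "vproj p (J p w) = d\<^sub>2.proj p (J p w)"
proof -
  have T: "w \<in> TM p" "J p w \<in> TM p" using assms d\<^sub>2.tangent J_tangent by blast+
  have "g p (J p w) u = 0" if u: "u \<in> D\<^sub>1 p" for u
  proof -
    have "u \<in> TM p" using u d\<^sub>1.tangent by blast
    then show ?thesis using J_skew[OF T(1)] J_orthogonal[OF u assms] g_sym J_tangent T(1) by force
  qed
  then have "d\<^sub>1.proj p (J p w) = 0"
    by (intro d\<^sub>1.proj_eqI[OF T(2) zero_in_D(1)]) (simp only: diff_zero)
  then show ?thesis by (simp only: vproj_eq[OF T(2)] add_0)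
qed

lemma P_sections: "X \<in> sections M D\<^sub>1 \<Longrightarrow> P X \<in> sections M D\<^sub>1"
    "V \<in> sections M D\<^sub>2 \<Longrightarrow> P V \<in> sections M D\<^sub>2"
proof -
  assume X: "X \<in> sections M D\<^sub>1"
  have "P X p \<in> D\<^sub>1 p" for p
    unfolding P_apply vproj_J_D\<^sub>1[OF sections_in[OF X]]
    by (intro d\<^sub>1.proj_in J_tangent vector_field_tangent sections_VF[OF X])
  then show "P X \<in> sections M D\<^sub>1" using P_VF[OF sections_VF[OF X]] by (simp add: sections_def)
next
  assume V: "V \<in> sections M D\<^sub>2"
  have "P V p \<in> D\<^sub>2 p" for p
    unfolding P_apply vproj_J_D\<^sub>2[OF sections_in[OF V]]
    by (intro d\<^sub>2.proj_in J_tangent vector_field_tangent sections_VF[OF V])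
  then show "P V \<in> sections M D\<^sub>2" using P_VF[OF sections_VF[OF V]] by (simp add: sections_def)
qed

text \<open>Horizontality of \<open>F X\<close> and isometry of \<open>J\<close> give
  \<open>g (F V, F X) = g (V, X) + g (J P X, V)\<close>. The first term vanishes as
  \<open>D\<^sub>1\<close> and \<open>D\<^sub>2\<close> are orthogonal, the second because
  \<open>P X\<close> stays in \<open>D\<^sub>1\<close>.\<close>

lemma F_D\<^sub>1_D\<^sub>2_orthogonal:
  assumes X: "X \<in> sections M D\<^sub>1" and V: "V \<in> sections M D\<^sub>2"
  shows "g p (F V p) (F X p) = 0"
proof -
  note VF = sections_VF[OF X] sections_VF[OF V]
  note T = vector_field_tangent[OF VF(1), of p] vector_field_tangent[OF VF(2), of p]
    J_tangent[OF vector_field_tangent[OF VF(1)], of p] J_tangent[OF vector_field_tangent[OF VF(2)], of p]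
    vector_field_tangent[OF F_VF[OF VF(1)], of p] vector_field_tangent[OF P_VF[OF VF(2)], of p]
    vector_field_tangent[OF P_VF[OF VF(1)], of p] J_tangent[OF vector_field_tangent[OF P_VF[OF VF(1)]], of p]
  have "g p (P V p) (F X p) = 0"
    using sections_in[OF F_horizontal[OF VF(1)]] sections_in[OF P_sections(2)[OF V]] D_vertical(2)
    by (blast intro: Vert_Horiz)
  then have "g p (F V p) (F X p) = g p (J p (V p)) (F X p)"
    using T by (simp only: F_apply[OF VF(2)] g_diff_left)
  also have "\<dots> = g p (V p) (X p) - g p (J p (V p)) (P X p)"
    using T by (simp only: F_apply[OF VF(1)] g_diff_right J_isometry)
  also have "g p (J p (V p)) (P X p) = - g p (J p (P X p)) (V p)"
    using J_skew[OF T(2,7)] g_sym[OF T(2,8)] by simp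
  also have "\<dots> = 0"
    using J_orthogonal[OF sections_in[OF P_sections(1)[OF X]] sections_in[OF V]] by simp
  also have "g p (V p) (X p) = 0"
    using D_orthogonal[OF sections_in[OF X] sections_in[OF V]] g_sym[OF T(1,2)] by simp
  finally show ?thesis by simp
qed

text \<open>\<open>X - X'\<close> vanishes at \<open>p\<close>, \<open>F\<close> is fibrewise
  linear, and the connection is tensorial in its direction. This permits the return from a section
  with basic \<open>F\<close>-part to an arbitrary one.\<close>

lemma nabla_F_tensorial:
  assumes X: "X \<in> sections M D\<^sub>1" "X' \<in> sections M D\<^sub>1" "X p = X' p" and Y: "Y \<in> VF"
  shows "nabla (F X) Y p = nabla (F X') Y p"
proof -
  note VF = sections_VF[OF X(1)] sections_VF[OF X(2)]
  have d: "X - X' \<in> VF" by (rule vector_field_diff[OF VF])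
  define h where "h q u = J q u - vproj q (J q u)" for q u
  have vadd: "vproj q (u + v) = vproj q u + vproj q v" if "u \<in> TM q" "v \<in> TM q" for q u v
    using that by (simp only: vproj_eq TM_add d\<^sub>1.proj_add d\<^sub>2.proj_add ac_simps)
  have vscale: "vproj q (c *\<^sub>R u) = c *\<^sub>R vproj q u" if "u \<in> TM q" for q c u
    using that by (simp only: vproj_eq TM_scale d\<^sub>1.proj_scale d\<^sub>2.proj_scale scaleR_add_right)
  have hF: "(\<lambda>q. h q (Z q)) = F Z" if "Z \<in> VF" for Z
    by (rule ext) (simp only: h_def F_apply[OF that] P_apply)
  have h_add: "h q (u + v) = h q u + h q v" if "u \<in> TM q" "v \<in> TM q" for q u v
    unfolding h_def using that by (simp only: J_add vadd J_tangent add_diff_add)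
  have h_scale: "h q (c *\<^sub>R u) = c *\<^sub>R h q u" if "u \<in> TM q" for q c u
    unfolding h_def using that by (simp only: J_scale vscale J_tangent scaleR_diff_right)
  have "F X q = F (X - X') q + F X' q" for q
    using h_add[OF vector_field_tangent[OF d] vector_field_tangent[OF VF(2)], of q]
    unfolding hF[OF d, symmetric] hF[OF VF(1), symmetric] hF[OF VF(2), symmetric]
    by (simp only: fun_diff_def[of X] diff_add_cancel)
  then have "F X = F (X - X') + F X'" by (intro ext) (simp only: plus_fun_apply[of "F _"])
  then have "nabla (F X) Y p = nabla (F (X - X')) Y p + nabla (F X') Y p"
    using fun_cong[OF nabla_add_left[OF F_VF[OF d] F_VF[OF VF(2)] Y], of p]
    by (simp only: plus_fun_apply[of "nabla _ _"])
  moreover have "nabla (\<lambda>q. h q ((X - X') q)) Y p = 0"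
  proof (rule nabla_tensorial_left[OF d\<^sub>1.tangent_distribution_axioms _ _ Y _ h_add h_scale])
    show "X - X' \<in> sections M D\<^sub>1"
      using d subspace_diff[OF d\<^sub>1.subspace] X(1,2) by (simp only: sections_def mem_Collect_eq fun_diff_def[of X]) blast
    show "(X - X') p = 0" by (simp only: fun_diff_def[of X] X(3) diff_self)
    show "(\<lambda>q. h q (Z q)) \<in> VF" if "Z \<in> VF" for Z using hF[OF that] F_VF[OF that] by metis
  qed
  ultimately show ?thesis by (simp only: hF[OF d] add_0)
qed

text \<open>On the left, \<open>X\<close> enters only by its value at \<open>p\<close>, and so does
  \<open>V\<close> once the derivative is moved onto \<open>F X\<close>. Hence both may be exchanged
  for sections whose \<open>F\<close>-parts are basic near \<open>p\<close>, where the symmetry for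
  basic fields applies.\<close>

lemma nabla_F_F:
  assumes X: "X \<in> sections M D\<^sub>1" and V: "V \<in> sections M D\<^sub>2" and U: "U \<in> sections M Vert"
    and basic: "basic_F_part M g J N \<pi> D\<^sub>1" "basic_F_part M g J N \<pi> D\<^sub>2"
  shows "g p (nabla U (F V) p) (F X p) = g p (nabla (F X) (F V) p) (U p)"
proof -
  obtain X' Y\<^sub>1 W\<^sub>1 where X': "X' \<in> sections M D\<^sub>1" "X' p = X p" and Y\<^sub>1: "basic M g N \<pi> Y\<^sub>1"
    and W\<^sub>1: "open W\<^sub>1" "p \<in> W\<^sub>1" "\<And>q. q \<in> W\<^sub>1 \<Longrightarrow> F X' q = Y\<^sub>1 q"
    using basic(1) sections_in[OF X] unfolding basic_F_part_def by meson
  obtain V' Y\<^sub>2 W\<^sub>2 where V': "V' \<in> sections M D\<^sub>2" "V' p = V p" and Y\<^sub>2: "basic M g N \<pi> Y\<^sub>2"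
    and W\<^sub>2: "open W\<^sub>2" "p \<in> W\<^sub>2" "\<And>q. q \<in> W\<^sub>2 \<Longrightarrow> F V' q = Y\<^sub>2 q"
    using basic(2) sections_in[OF V] unfolding basic_F_part_def by meson
  have FX': "F X' p = F X p" and FV': "F V' p = F V p"
    using X' V' X V by (simp_all only: F_apply P_apply sections_VF)
  have Y: "Y\<^sub>1 \<in> sections M Horiz" "Y\<^sub>2 \<in> sections M Horiz" using Y\<^sub>1 Y\<^sub>2 by (auto simp: basic_def)
  note VF = F_VF[OF sections_VF[OF X]] F_VF[OF sections_VF[OF X'(1)]]
    F_VF[OF sections_VF[OF V]] F_VF[OF sections_VF[OF V'(1)]] sections_VF[OF Y(1)] sections_VF[OF Y(2)]
    sections_VF[OF U]
  have H: "g q (Z q) (U q) = 0" if "Z \<in> sections M Horiz" for Z q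
    using Horiz_Vert sections_in[OF that] sections_in[OF U] by blast
  have "g p (nabla U (F V) p) (F X p) = - g p (F V p) (nabla U (F X) p)"
    by (rule nabla_orthogonal[OF VF(7,3,1) F_D\<^sub>1_D\<^sub>2_orthogonal[OF X V]])
  also have "\<dots> = g p (nabla U (F V') p) (F X p)"
    unfolding FV'[symmetric] using nabla_orthogonal[OF VF(7,4,1) F_D\<^sub>1_D\<^sub>2_orthogonal[OF X V'(1)]] by simp
  also have "\<dots> = g p (nabla U Y\<^sub>2 p) (Y\<^sub>1 p)"
    using nabla_local_right[OF VF(7,4,6) W\<^sub>2] W\<^sub>1(3)[OF W\<^sub>1(2)] FX' by simp
  also have "\<dots> = g p (nabla Y\<^sub>1 Y\<^sub>2 p) (U p)"
    by (rule nabla_basic_symmetric[OF Y\<^sub>1 Y\<^sub>2 U])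
  \<comment> \<open>With the derivative on the vertical \<open>U\<close>, the basic field
    \<open>Y\<^sub>2\<close> counts only by its value at \<open>p\<close>, and the direction can be
    changed by locality and tensoriality.\<close>
  also have "\<dots> = - g p (Y\<^sub>2 p) (nabla Y\<^sub>1 U p)"
    by (rule nabla_orthogonal[OF VF(5,6,7) H[OF Y(2)]])
  also have "nabla Y\<^sub>1 U p = nabla (F X') U p"
    by (rule nabla_local_left[OF VF(2,5,7) W\<^sub>1, symmetric])
  also have "\<dots> = nabla (F X) U p"
    by (rule nabla_F_tensorial[OF X'(1) X X'(2) VF(7)])
  also have "Y\<^sub>2 p = F V p" using W\<^sub>2(3)[OF W\<^sub>2(2)] FV' by simp
  also have "- g p (F V p) (nabla (F X) U p) = g p (nabla (F X) (F V) p) (U p)"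
    by (rule nabla_orthogonal[OF VF(1,3,7) H[OF F_horizontal[OF sections_VF[OF V]]], symmetric])
  finally show ?thesis .
qed

section \<open>The slant constant and the square of \<open>P\<close>\<close>

text \<open>Here \<open>c = cos\<^sup>2 \<theta>\<^sub>2\<close>, except that \<open>c = 0\<close> if \<open>D\<^sub>2 = 0\<close>: then \<open>\<theta>\<^sub>2\<close> is an arbitrary nonzero real.\<close>

lemma slant_constant:
  assumes "\<theta>\<^sub>2 \<noteq> 0"
  obtains c where "c \<noteq> 1"
    "\<And>p x. x \<in> D\<^sub>2 p \<Longrightarrow> g p (d\<^sub>2.proj p (J p x)) (d\<^sub>2.proj p (J p x)) = c * g p x x"
proof -
  have slant: "0 \<le> cos \<theta>\<^sub>2 \<and> cos \<theta>\<^sub>2 \<noteq> 1 \<and>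
      g p (d\<^sub>2.proj p (J p x)) (d\<^sub>2.proj p (J p x)) = (cos \<theta>\<^sub>2)\<^sup>2 * g p x x"
    if x: "x \<in> D\<^sub>2 p" and "x \<noteq> 0" for p x
  proof -
    let ?v = "d\<^sub>2.proj p (J p x)"
    \<comment> \<open>The cosine in the definition of the slant angle, where \<open>|J x|\<close>
      has been replaced by the equal length \<open>|x|\<close>.\<close>
    define r where "r = sqrt (g p ?v ?v) / sqrt (g p x x)"
    have T: "x \<in> TM p" "J p x \<in> TM p" "?v \<in> TM p"
      using x d\<^sub>2.tangent J_tangent d\<^sub>2.proj_tangent by blast+
    have pos: "g p x x > 0" "g p ?v ?v \<ge> 0" using g_pos T(1) \<open>x \<noteq> 0\<close> g_nonneg T(3) by blast+
    \<comment> \<open>Pythagoras for \<open>J x\<close> and its projection yields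
      \<open>r \<le> 1\<close>, so that \<open>cos\<close> inverts \<open>arccos\<close> at
      \<open>r\<close>.\<close>
    have "0 \<le> g p (J p x - ?v) (J p x - ?v)" using T by (intro g_nonneg TM_diff)
    also have "\<dots> = g p (J p x) (J p x) - g p ?v (J p x) - g p (J p x - ?v) ?v"
      using T by (simp only: g_diff_left g_diff_right TM_diff)
    also have "\<dots> = g p x x - g p ?v ?v"
      using d\<^sub>2.proj_inner[OF T(2) d\<^sub>2.proj_in[OF T(2)]] d\<^sub>2.proj_orth[OF T(2) d\<^sub>2.proj_in[OF T(2)]]
        g_sym[OF T(2,3)] J_isometry[OF T(1,1)] by simp
    finally have r: "0 \<le> r" "r \<le> 1" "r\<^sup>2 * g p x x = g p ?v ?v"
      using pos unfolding r_def by (auto simp: power_divide real_sqrt_le_iff)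
    have "angle_to_subspace g p (J p x) (D\<^sub>2 p) = \<theta>\<^sub>2"
      using bi_slant x \<open>x \<noteq> 0\<close> unfolding bi_slant_submersion_def slant_distribution_def by blast
    then have "arccos r = \<theta>\<^sub>2"
      using J_isometry[OF T(1,1)] unfolding angle_to_subspace_def r_def by simp
    then have "cos \<theta>\<^sub>2 = r" "r \<noteq> 1" using r assms by auto
    then show ?thesis using r by simp
  qed
  show thesis
  proof (cases "\<exists>p x. x \<in> D\<^sub>2 p \<and> x \<noteq> 0")
    case True
    \<comment> \<open>The value \<open>1\<close> of the cosine is excluded since the slant angle is
      nonzero, the value \<open>-1\<close> by nonnegativity of the cosine.\<close>
    then have "(cos \<theta>\<^sub>2)\<^sup>2 \<noteq> 1" using slant by (auto simp: power2_eq_1_iff)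
    moreover have "g p (d\<^sub>2.proj p (J p x)) (d\<^sub>2.proj p (J p x)) = (cos \<theta>\<^sub>2)\<^sup>2 * g p x x"
      if "x \<in> D\<^sub>2 p" for p x
    proof (cases "x = 0")
      case False
      then show ?thesis using slant that by blast
    next
      case True
      have "J p 0 = 0" using J_scale[OF TM_0, of p 0] by (simp only: scaleR_zero_left)
      moreover have "d\<^sub>2.proj p 0 = 0"
        using d\<^sub>2.proj_scale[OF TM_0, of p 0] by (simp only: scaleR_zero_left)
      ultimately show ?thesis using True g_0(1)[OF TM_0] by (simp only: mult_zero_right)
    qed
    ultimately show thesis by (rule that)
  next
    case False
    have "J p 0 = 0" for p using J_scale[OF TM_0, of p 0] by (simp only: scaleR_zero_left)
    moreover have "d\<^sub>2.proj p 0 = 0" for p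
      using d\<^sub>2.proj_scale[OF TM_0, of p 0] by (simp only: scaleR_zero_left)
    ultimately have "g p (d\<^sub>2.proj p (J p x)) (d\<^sub>2.proj p (J p x)) = 0 * g p x x"
      if "x \<in> D\<^sub>2 p" for p x
      using False that g_0(1)[OF TM_0, of p] by (metis mult_zero_left)
    then show thesis using that[of 0] by simp
  qed
qed

text \<open>The projected \<open>J\<close> on \<open>D\<^sub>2\<close>, called \<open>S\<close>, is
  skew and scales squared lengths by \<open>c\<close>. Polarisation gives
  \<open>g (S x, S y) = c g (x, y)\<close>, and skewness turns this into
  \<open>S\<^sup>2 = - c\<close>.\<close>

lemma P_P:
  assumes c: "\<And>p x. x \<in> D\<^sub>2 p \<Longrightarrow> g p (d\<^sub>2.proj p (J p x)) (d\<^sub>2.proj p (J p x)) = c * g p x x"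
    and V: "V \<in> sections M D\<^sub>2"
  shows "P (P V) = (\<lambda>p. (- c) *\<^sub>R V p)"
proof
  fix p
  define S where "S x = d\<^sub>2.proj p (J p x)" for x
  have T: "x \<in> TM p" "J p x \<in> TM p" "S x \<in> TM p" "S x \<in> D\<^sub>2 p" if "x \<in> D\<^sub>2 p" for x
    using that d\<^sub>2.tangent J_tangent d\<^sub>2.proj_tangent d\<^sub>2.proj_in unfolding S_def by blast+
  have polar: "g p (S x) (S y) = c * g p x y" if x: "x \<in> D\<^sub>2 p" and y: "y \<in> D\<^sub>2 p" for x y
  proof -
    have xy: "x + y \<in> D\<^sub>2 p" using x y by (rule subspace_add[OF d\<^sub>2.subspace])
    have "S (x + y) = S x + S y"
      unfolding S_def using T[OF x] T[OF y] by (simp only: J_add d\<^sub>2.proj_add)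
    then have "g p (S x + S y) (S x + S y) = c * g p (x + y) (x + y)"
      using c[OF xy] unfolding S_def by simp
    then have "g p (S x) (S x) + g p (S y) (S x) + (g p (S x) (S y) + g p (S y) (S y)) =
        c * (g p x x + g p y x + (g p x y + g p y y))"
      using T[OF x] T[OF y] by (simp only: g_add_left g_add_right TM_add)
    then show ?thesis
      using c[OF x] c[OF y] g_sym[OF T(3)[OF x] T(3)[OF y]] g_sym[OF T(1)[OF x] T(1)[OF y]]
      unfolding S_def by (simp add: algebra_simps)
  qed
  have v: "V p \<in> D\<^sub>2 p" by (rule sections_in[OF V])
  have "S (S (V p)) = (- c) *\<^sub>R V p"
    unfolding S_def[of "S _"]
  proof (rule d\<^sub>2.proj_eqI)
    show "J p (S (V p)) \<in> TM p" using T(2,4) v by blast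
    show "(- c) *\<^sub>R V p \<in> D\<^sub>2 p" using v by (rule subspace_scale[OF d\<^sub>2.subspace])
    fix u assume u: "u \<in> D\<^sub>2 p"
    have "g p (J p (S (V p))) u = - g p (S (V p)) (J p u)"
      by (rule J_skew[OF T(3)[OF v] T(1)[OF u]])
    also have "g p (S (V p)) (J p u) = g p (S u) (S (V p))"
      using d\<^sub>2.proj_inner[OF T(2)[OF u] T(4)[OF v]] g_sym[OF T(2)[OF u] T(3)[OF v]]
      unfolding S_def[of u] by simp
    also have "\<dots> = c * g p (V p) u"
      using polar[OF u v] g_sym[OF T(1)[OF u] T(1)[OF v]] by simp
    finally show "g p (J p (S (V p)) - (- c) *\<^sub>R V p) u = 0"
      using T(1)[OF u] T(1)[OF v] T(2)[OF T(4)[OF v]]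
      by (simp only: g_diff_left g_scale_left TM_scale)
  qed
  moreover have "P V p = S (V p)" unfolding P_apply S_def by (rule vproj_J_D\<^sub>2[OF v])
  ultimately show "P (P V) p = (- c) *\<^sub>R V p"
    using vproj_J_D\<^sub>2[OF T(4)[OF v]] unfolding P_apply[of "P V"] S_def by simp
qed

lemma nabla_D\<^sub>2_D\<^sub>1:
  assumes c: "\<And>p x. x \<in> D\<^sub>2 p \<Longrightarrow> g p (d\<^sub>2.proj p (J p x)) (d\<^sub>2.proj p (J p x)) = c * g p x x"
    and basic: "basic_F_part M g J N \<pi> D\<^sub>1" "basic_F_part M g J N \<pi> D\<^sub>2"
    and X: "X \<in> sections M D\<^sub>1" and V: "V \<in> sections M D\<^sub>2" and U: "U \<in> sections M D\<^sub>2"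
  shows "(1 - c) * g p (nabla U V p) (X p) =
    g p (nabla (P X) (F V) p) (U p) - g p (nabla X (F (P V)) p) (U p) + g p (nabla (F X) (F V) p) (U p)"
proof -
  note vert = subsetD[OF sections_vertical(1) X] subsetD[OF sections_vertical(2) V]
    subsetD[OF sections_vertical(2) U] subsetD[OF sections_vertical(1) P_sections(1)[OF X]]
  note UV = sections_VF[OF U] and VV = sections_VF[OF V] and XV = sections_VF[OF X]
  note PV = P_VF[OF VV] and FV = F_VF[OF VV] and FPV = F_VF[OF P_VF[OF VV]]
  note T = vector_field_tangent
  have PPV: "nabla U (P (P V)) p = (- c) *\<^sub>R nabla U V p"
  proof -
    \<comment> \<open>That \<open>c\<close> is the same at all points enters here: the Leibniz term
      drops out, as a derivation kills constants by \<open>1 = 1 * 1\<close>.\<close>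
    have "U p (\<lambda>x. - c) = 0"
      using tangent_mult[OF T[OF UV] smooth_fun_const[of 1] smooth_fun_const[of 1]]
        tangent_scale[OF T[OF UV] smooth_fun_const[of 1], of p "- c"] by simp
    moreover have "nabla U (\<lambda>p. (- c) *\<^sub>R V p) p = U p (\<lambda>x. - c) *\<^sub>R V p + (- c) *\<^sub>R nabla U V p"
      using nabla_scale_right[OF UV VV smooth_fun_const] by (rule fun_cong)
    ultimately have "nabla U (\<lambda>p. (- c) *\<^sub>R V p) p = 0 *\<^sub>R V p + (- c) *\<^sub>R nabla U V p"
      by metis
    also have "\<dots> = (- c) *\<^sub>R nabla U V p" by (simp only: scaleR_zero_left add_0)
    finally show ?thesis using P_P[OF c V] by metis
  qed
  have J_PV: "J p (nabla U (P V) p) = (- c) *\<^sub>R nabla U V p + nabla U (F (P V)) p"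
  proof -
    have "J p (nabla U (P V) p) = nabla U (P (P V) + F (P V)) p"
      using fun_cong[OF nabla_J[OF UV PV], of p] J_decomposition[OF PV] by metis
    also have "\<dots> = nabla U (P (P V)) p + nabla U (F (P V)) p"
      using fun_cong[OF nabla_add_right[OF UV P_VF[OF PV] FPV], of p]
      by (simp only: plus_fun_apply[of "nabla _ _"])
    finally show ?thesis unfolding PPV .
  qed
  have J_V: "J p (nabla U V p) = nabla U (P V) p + nabla U (F V) p"
  proof -
    have "J p (nabla U V p) = nabla U (P V + F V) p"
      using fun_cong[OF nabla_J[OF UV VV], of p] J_decomposition[OF VV] by metis
    also have "\<dots> = nabla U (P V) p + nabla U (F V) p"
      using fun_cong[OF nabla_add_right[OF UV PV FV], of p] by (simp only: plus_fun_apply[of "nabla _ _"])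
    finally show ?thesis .
  qed
  have J_X: "J p (X p) = P X p + F X p"
    using fun_cong[OF J_decomposition[OF XV], of p] by (simp only: plus_fun_apply[of "P X"])
  note tan = T[OF XV, of p] J_tangent[OF T[OF XV], of p] T[OF P_VF[OF XV], of p] T[OF F_VF[OF XV], of p]
    nabla_tangent[OF UV VV, of p] nabla_tangent[OF UV PV, of p] nabla_tangent[OF UV FV, of p]
    nabla_tangent[OF UV FPV, of p]
  have "g p (nabla U V p) (X p) = g p (J p (nabla U V p)) (J p (X p))"
    by (rule J_isometry[OF tan(5,1), symmetric])
  also have "\<dots> = g p (nabla U (P V) p) (J p (X p)) + g p (nabla U (F V) p) (J p (X p))"
    unfolding J_V by (rule g_add_left[OF tan(6,7,2)])
  \<comment> \<open>\<open>J\<close> goes back onto \<open>P V\<close>, where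
    \<open>J P V = P\<^sup>2 V + F P V\<close> reproduces the quantity to be computed; this is the
    source of the factor \<open>1 - c\<close>.\<close>
  also have "g p (nabla U (P V) p) (J p (X p)) = - g p (J p (nabla U (P V) p)) (X p)"
    using J_skew[OF tan(6,1)] by simp
  also have "g p (J p (nabla U (P V) p)) (X p) = - c * g p (nabla U V p) (X p) + g p (nabla U (F (P V)) p) (X p)"
    unfolding J_PV using tan by (simp only: g_add_left g_scale_left TM_scale)
  also have "g p (nabla U (F V) p) (J p (X p)) = g p (nabla U (F V) p) (P X p) + g p (nabla U (F V) p) (F X p)"
    unfolding J_X by (rule g_add_right[OF tan(3,4,7)])
  also have "g p (nabla U (F (P V)) p) (X p) = g p (nabla X (F (P V)) p) (U p)"
    by (rule nabla_vertical_horizontal_symmetric[OF vert(3,1) F_horizontal[OF PV]])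
  also have "g p (nabla U (F V) p) (P X p) = g p (nabla (P X) (F V) p) (U p)"
    by (rule nabla_vertical_horizontal_symmetric[OF vert(3,4) F_horizontal[OF VV]])
  also have "g p (nabla U (F V) p) (F X p) = g p (nabla (F X) (F V) p) (U p)"
    by (rule nabla_F_F[OF X V vert(3) basic])
  finally show ?thesis by (simp add: algebra_simps)
qed

section \<open>From O'Neill's tensors back to the connection\<close>

lemma ver_apply: "ver M g N \<pi> X p = vproj p (X p)"
  and hor_apply: "hor M g N \<pi> X p = hproj p (X p)"
  by (simp_all only: ver_def hor_def)

lemma ver_section: "X \<in> sections M Vert \<Longrightarrow> ver M g N \<pi> X = X"
  unfolding ver_def using vproj_vertical sections_in by blast

lemma hor_section: "X \<in> sections M Horiz \<Longrightarrow> hor M g N \<pi> X = X"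
  unfolding hor_def using hproj_horizontal sections_in by blast

lemma hproj_Horiz: "v \<in> TM p \<Longrightarrow> hproj p v \<in> Horiz p"
  using hproj_in hproj_eq by metis

text \<open>Values of O'Neill's tensors are a vertical plus a horizontal projection; paired with a
  vertical vector only the first survives, whatever \<open>w\<close> is.\<close>

lemma vproj_hproj_inner:
  assumes "v \<in> TM p" "w \<in> TM p" "u \<in> Vert p"
  shows "vproj p v + hproj p w \<in> TM p" "g p (vproj p v + hproj p w) u = g p v u"
proof -
  note T = Vert_tangent[OF vproj_in[OF assms(1)]] Horiz_tangent[OF hproj_Horiz[OF assms(2)]] Vert_tangent[OF assms(3)]
  show "vproj p v + hproj p w \<in> TM p" using T(1,2) by (rule TM_add)
  show "g p (vproj p v + hproj p w) u = g p v u"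
    using g_add_left[OF T] vproj_inner[OF assms(1,3)] Horiz_Vert[OF hproj_Horiz[OF assms(2)] assms(3)]
    by simp
qed

lemma oneill_T_inner:
  assumes "B \<in> sections M Vert" "Y \<in> sections M Horiz" "u \<in> Vert p"
  shows "oneill_T M g nabla N \<pi> B Y p \<in> TM p"
    "g p (oneill_T M g nabla N \<pi> B Y p) u = g p (nabla B Y p) u"
proof -
  note VF = assms(1,2)[THEN sections_VF]
  have eq: "oneill_T M g nabla N \<pi> B Y p = vproj p (nabla B Y p) + hproj p (nabla B (ver M g N \<pi> Y) p)"
    unfolding oneill_T_def ver_section[OF assms(1)] hor_section[OF assms(2)]
    by (simp only: plus_fun_apply[of "ver M g N \<pi> _"] ver_apply hor_apply)
  show "oneill_T M g nabla N \<pi> B Y p \<in> TM p"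
    "g p (oneill_T M g nabla N \<pi> B Y p) u = g p (nabla B Y p) u"
    unfolding eq
    by (intro vproj_hproj_inner[OF _ _ assms(3)] nabla_tangent VF ver_VF)+
qed

lemma oneill_A_inner:
  assumes "B \<in> sections M Horiz" "Y \<in> sections M Horiz" "u \<in> Vert p"
  shows "oneill_A M g nabla N \<pi> B Y p \<in> TM p"
    "g p (oneill_A M g nabla N \<pi> B Y p) u = g p (nabla B Y p) u"
proof -
  note VF = assms(1,2)[THEN sections_VF]
  have eq: "oneill_A M g nabla N \<pi> B Y p = vproj p (nabla B Y p) + hproj p (nabla B (ver M g N \<pi> Y) p)"
    unfolding oneill_A_def hor_section[OF assms(1)] hor_section[OF assms(2)]
    by (simp only: plus_fun_apply[of "ver M g N \<pi> _"] ver_apply hor_apply)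
  show "oneill_A M g nabla N \<pi> B Y p \<in> TM p"
    "g p (oneill_A M g nabla N \<pi> B Y p) u = g p (nabla B Y p) u"
    unfolding eq
    by (intro vproj_hproj_inner[OF _ _ assms(3)] nabla_tangent VF ver_VF)+
qed

lemma oneill_condition:
  assumes X: "X \<in> sections M D\<^sub>1" and U: "U \<in> sections M D\<^sub>2" and V: "V \<in> sections M D\<^sub>2"
  shows "g p (oneill_T M g nabla N \<pi> (P X) (F V) p - oneill_T M g nabla N \<pi> X (F (P V)) p +
      oneill_A M g nabla N \<pi> (F X) (F V) p) (U p) =
    g p (nabla (P X) (F V) p) (U p) - g p (nabla X (F (P V)) p) (U p) + g p (nabla (F X) (F V) p) (U p)"
proof -
  have u: "U p \<in> Vert p" using sections_in[OF U] D_vertical by blast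
  note VF = sections_VF[OF X] sections_VF[OF V]
  note 1 = oneill_T_inner[OF subsetD[OF sections_vertical(1) P_sections(1)[OF X]] F_horizontal[OF VF(2)] u]
    and 2 = oneill_T_inner[OF subsetD[OF sections_vertical(1) X] F_horizontal[OF P_VF[OF VF(2)]] u]
    and 3 = oneill_A_inner[OF F_horizontal[OF VF(1)] F_horizontal[OF VF(2)] u]
  show ?thesis
    using 1 2 3 Vert_tangent[OF u] by (simp only: g_add_left g_diff_left TM_diff)
qed

text \<open>The vertical part of \<open>nabla U V\<close> lies in \<open>D\<^sub>2\<close> exactly
  when its \<open>D\<^sub>1\<close> component vanishes. That component is tested with vectors at a
  point, the right side with sections; \<open>extend\<close> bridges the two.\<close>

lemma totally_geodesic_iff:
  assumes extend: "\<And>p u. u \<in> D\<^sub>1 p \<Longrightarrow> \<exists>X\<in>sections M D\<^sub>1. X p = u"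
  shows "vertical_totally_geodesic M g nabla N \<pi> D\<^sub>2 \<longleftrightarrow>
    (\<forall>X\<in>sections M D\<^sub>1. \<forall>U\<in>sections M D\<^sub>2. \<forall>V\<in>sections M D\<^sub>2. \<forall>p. g p (nabla U V p) (X p) = 0)"
    (is "?L \<longleftrightarrow> ?R")
proof
  assume L: ?L
  show ?R
  proof (intro ballI allI)
    fix X U V p assume X: "X \<in> sections M D\<^sub>1" and U: "U \<in> sections M D\<^sub>2" and V: "V \<in> sections M D\<^sub>2"
    let ?w = "nabla U V p"
    have w: "?w \<in> TM p" by (rule nabla_tangent[OF sections_VF[OF U] sections_VF[OF V]])
    have "vproj p ?w \<in> D\<^sub>2 p"
      using L U V sections_in unfolding vertical_totally_geodesic_def ver_def by fast
    then have "g p (X p) (vproj p ?w) = 0" by (rule D_orthogonal[OF sections_in[OF X]])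
    moreover have "X p \<in> Vert p" using sections_in[OF X] D_vertical by blast
    ultimately show "g p ?w (X p) = 0"
      using vproj_inner[OF w] g_sym[OF Vert_tangent Vert_tangent] vproj_in[OF w] by metis
  qed
next
  assume R: ?R
  show ?L
    unfolding vertical_totally_geodesic_def
  proof (intro ballI)
    fix U V assume U: "U \<in> sections M D\<^sub>2" and V: "V \<in> sections M D\<^sub>2"
    have n: "nabla U V \<in> VF" by (rule nabla_VF[OF sections_VF[OF U] sections_VF[OF V]])
    have "vproj p (nabla U V p) \<in> D\<^sub>2 p" for p
    proof -
      note T = vector_field_tangent[OF n, of p]
      have "d\<^sub>1.proj p (nabla U V p) = 0"
      proof (rule d\<^sub>1.proj_eqI[OF T zero_in_D(1)])
        fix u assume "u \<in> D\<^sub>1 p"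
        then show "g p (nabla U V p - 0) u = 0" using extend R U V unfolding diff_zero by metis
      qed
      then show ?thesis using d\<^sub>2.proj_in[OF T] by (simp only: vproj_eq[OF T] add_0)
    qed
    then show "ver M g N \<pi> (nabla U V) \<in> sections M D\<^sub>2"
      using ver_VF[OF n] by (simp add: sections_def ver_def)
  qed
qed

end

theorem theorem3p10:
  fixes M :: "('m::{t2_space,second_countable_topology}, 'e::euclidean_space) atlas"
    and N :: "('n::{t2_space,second_countable_topology}, 'd::euclidean_space) atlas"
    and g :: "'m metric" and g\<^sub>N :: "'n metric"
    and J :: "'m \<Rightarrow> 'm tvec \<Rightarrow> 'm tvec"
    and nabla :: "'m vfield \<Rightarrow> 'm vfield \<Rightarrow> 'm vfield"
    and \<pi> :: "'m \<Rightarrow> 'n"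
    and D\<^sub>1 D\<^sub>2 :: "'m \<Rightarrow> 'm tvec set"
    and \<theta>\<^sub>1 \<theta>\<^sub>2 :: real
  defines "P \<equiv> P_part M g J N \<pi>" and "F \<equiv> F_part M g J N \<pi>"
    and "T \<equiv> oneill_T M g nabla N \<pi>" and "A \<equiv> oneill_A M g nabla N \<pi>"
  assumes "smooth_atlas M" and "kaehler M g J nabla"
    and "smooth_atlas N" and "riemannian_metric N g\<^sub>N"
    and "bi_slant_submersion M g J N g\<^sub>N \<pi> D\<^sub>1 \<theta>\<^sub>1 D\<^sub>2 \<theta>\<^sub>2"
    and proper: "\<theta>\<^sub>1 \<notin> {0, pi / 2}" "\<theta>\<^sub>2 \<notin> {0, pi / 2}"
    and J_orthogonal: "\<And>p u w. u \<in> D\<^sub>1 p \<Longrightarrow> w \<in> D\<^sub>2 p \<Longrightarrow> g p (J p u) w = 0"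
    and basic_convention: "basic_F_part M g J N \<pi> D\<^sub>1" "basic_F_part M g J N \<pi> D\<^sub>2"
  shows "vertical_totally_geodesic M g nabla N \<pi> D\<^sub>2 \<longleftrightarrow>
    (\<forall>X\<in>sections M D\<^sub>1. \<forall>U\<in>sections M D\<^sub>2. \<forall>V\<in>sections M D\<^sub>2. \<forall>p.
       g p (T (P X) (F V) p - T X (F (P V)) p + A (F X) (F V) p) (U p) = 0)"
proof -
  interpret bi_slant M g nabla N g\<^sub>N J \<pi> D\<^sub>1 D\<^sub>2 \<theta>\<^sub>1 \<theta>\<^sub>2
  proof unfold_locales
    show "riemannian_metric M g" "levi_civita M g nabla"
      using assms(6) by (simp_all only: kaehler_def)
  qed (use assms in blast)+
  obtain c where c: "c \<noteq> 1"
    "\<And>p x. x \<in> D\<^sub>2 p \<Longrightarrow> g p (d\<^sub>2.proj p (J p x)) (d\<^sub>2.proj p (J p x)) = c * g p x x"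
    using slant_constant proper(2) by blast
  \<comment> \<open>The basic convention also provides a section through every vector of
    \<open>D\<^sub>1 p\<close>.\<close>
  have "\<exists>X\<in>sections M D\<^sub>1. X p = u" if "u \<in> D\<^sub>1 p" for p u
    using basic_convention(1) that unfolding basic_F_part_def by blast
  note totally_geodesic_iff[OF this]
  \<comment> \<open>At each point the two conditions differ by the nonzero constant
    \<open>1 - c\<close>.\<close>
  moreover have "g p (T (P X) (F V) p - T X (F (P V)) p + A (F X) (F V) p) (U p) =
      (1 - c) * g p (nabla U V p) (X p)"
    if "X \<in> sections M D\<^sub>1" "U \<in> sections M D\<^sub>2" "V \<in> sections M D\<^sub>2" for X U V p
    unfolding P_def F_def T_def A_def
    using oneill_condition[OF that] nabla_D\<^sub>2_D\<^sub>1[OF c(2) basic_convention that(1,3,2)] by simp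
  ultimately show ?thesis using c(1) by simp
qed

end
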